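(* Let $H$ be a graph with no isolated vertices. For each $v\in V(H)$ let $B_v\subseteq[0,1]$ be measurable, and for each edge $e=\{v,v'\}\in E(H)$ let $f_e:B_v\times B_{v'}\to\mathbb R$ be bounded and measurable (with arguments written $f_e(x_v,x_{v'})$). Let $(w_e)_{e\in E(H)}$ be a maximum fractional matching and $(w'_e)_{e\in E(H)}$ a minimum fractional edge cover of $H$ with $w'_e\ge w_e$ for all $e$, and let $S'=\{v\in V(H):\sum_{e\ni v}w'_e>1\}$. Then \[\int_{\prod_v B_v}\prod_{e=\{v,v'\}\in E(H)}f_e(x_v,x_{v'})\prod_{v}dx_v\leq\left(\prod_{v\in S'}\prod_{e\ni v}\|f_e\|_{v,\frac{1}{w'_e}}^{\frac{w'_e-w_e}{w'_e}}\right)\prod_{e\in E(H)}\|f_e\|_{\frac{1}{w'_e}}^{\frac{w_e}{w'_e}},\] where $\frac10=\infty$, and when $w'_e=w_e=0$ one takes $\frac{w'_e-w_e}{w'_e}=0$ and $\frac{w_e}{w'_e}=1$.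
   Context: A fractional matching of $H$ is $(w_e)$ with $w_e\ge0$ and $\sum_{e\ni v}w_e\le1$ for all $v$; a fractional edge cover has $w_e\ge0$ and $\sum_{e\ni v}w_e\ge1$ for all $v$. With $c(H)$ the minimum total weight of a fractional vertex cover ($c_v\ge0$, $c_v+c_w\ge1$ on edges), a fractional matching is maximum if its total weight is $c(H)$ and a fractional edge cover is minimum if its total weight is $v(H)-c(H)$. For $e=\{v,v'\}$ and $a\in(0,\infty)$, $S^a_vf_e(x_v)=\left(\int_{B_{v'}}|f_e(x_v,x_{v'})|^adx_{v'}\right)^{1/a}$, and $S^\infty_vf_e(x_v)=\operatorname{ess\,sup}_{x_{v'}\in B_{v'}}|f_e(x_v,x_{v'})|$; $\|f_e\|_{v,a}=\operatorname{ess\,sup}_{x_v\in B_v}S^a_vf_e(x_v)$. $\|f_e\|_a$ is the $L^a$ norm of $f_e$ on $B_v\times B_{v'}$ with Lebesgue measure. *)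

theory Defs
  imports "HOL-Probability.Essential_Supremum"
begin

definition simple_graph :: "'a set \<Rightarrow> 'a set set \<Rightarrow> bool" where
  "simple_graph V E \<longleftrightarrow> finite V \<and> (\<forall>e\<in>E. e \<subseteq> V \<and> card e = 2)"

definition no_isolated_vertices :: "'a set \<Rightarrow> 'a set set \<Rightarrow> bool" where
  "no_isolated_vertices V E \<longleftrightarrow> (\<forall>v\<in>V. \<exists>e\<in>E. v \<in> e)"

definition fractional_vertex_cover :: "'a set \<Rightarrow> 'a set set \<Rightarrow> ('a \<Rightarrow> real) \<Rightarrow> bool" where
  "fractional_vertex_cover V E c \<longleftrightarrow>
     (\<forall>v\<in>V. 0 \<le> c v) \<and> (\<forall>v w. {v, w} \<in> E \<longrightarrow> 1 \<le> c v + c w)"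

(* The infimum of a nonempty set of reals bounded below by 0; it is attained, since it is the
   value of a linear program. *)
definition fractional_cover_number :: "'a set \<Rightarrow> 'a set set \<Rightarrow> real" where
  "fractional_cover_number V E = Inf {(\<Sum>v\<in>V. c v) | c. fractional_vertex_cover V E c}"

definition fractional_matching :: "'a set \<Rightarrow> 'a set set \<Rightarrow> ('a set \<Rightarrow> real) \<Rightarrow> bool" where
  "fractional_matching V E w \<longleftrightarrow>
     (\<forall>e\<in>E. 0 \<le> w e) \<and> (\<forall>v\<in>V. (\<Sum>e | e \<in> E \<and> v \<in> e. w e) \<le> 1)"

definition fractional_edge_cover :: "'a set \<Rightarrow> 'a set set \<Rightarrow> ('a set \<Rightarrow> real) \<Rightarrow> bool" where
  "fractional_edge_cover V E w \<longleftrightarrow>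
     (\<forall>e\<in>E. 0 \<le> w e) \<and> (\<forall>v\<in>V. 1 \<le> (\<Sum>e | e \<in> E \<and> v \<in> e. w e))"

definition max_fractional_matching :: "'a set \<Rightarrow> 'a set set \<Rightarrow> ('a set \<Rightarrow> real) \<Rightarrow> bool" where
  "max_fractional_matching V E w \<longleftrightarrow>
     fractional_matching V E w \<and> (\<Sum>e\<in>E. w e) = fractional_cover_number V E"

definition min_fractional_edge_cover :: "'a set \<Rightarrow> 'a set set \<Rightarrow> ('a set \<Rightarrow> real) \<Rightarrow> bool" where
  "min_fractional_edge_cover V E w \<longleftrightarrow>
     fractional_edge_cover V E w \<and> (\<Sum>e\<in>E. w e) = real (card V) - fractional_cover_number V E"

(* Lebesgue measure on the product of the B v over v in A.  The completion is needed because a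
   product of Lebesgue measures is not complete in itself. *)
definition box_measure :: "('a \<Rightarrow> real set) \<Rightarrow> 'a set \<Rightarrow> ('a \<Rightarrow> real) measure" where
  "box_measure B A = completion (PiM A (\<lambda>v. lebesgue_on (B v)))"

(* The norm is taken in the reals, so it has the intended value only when the extended
   norm is finite; an infinite one would become 0.  Below it is used for bounded functions on
   spaces of finite measure. *)
definition ess_sup_abs :: "'b measure \<Rightarrow> ('b \<Rightarrow> real) \<Rightarrow> real" where
  "ess_sup_abs M g = enn2real (esssup M (\<lambda>x. ennreal \<bar>g x\<bar>))"

definition L_norm :: "'b measure \<Rightarrow> ennreal \<Rightarrow> ('b \<Rightarrow> real) \<Rightarrow> real" where
  "L_norm M a g =
     (if a = top then ess_sup_abs M g
      else (\<integral>x. \<bar>g x\<bar> powr enn2real a \<partial>M) powr (1 / enn2real a))"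

definition other_end :: "'a set \<Rightarrow> 'a \<Rightarrow> 'a" where
  "other_end e v = the_elem (e - {v})"

definition edge_point :: "'a set \<Rightarrow> 'a \<Rightarrow> real \<Rightarrow> real \<Rightarrow> 'a \<Rightarrow> real" where
  "edge_point e v s t = (\<lambda>u\<in>e. if u = v then s else t)"

(* A function f on the product of B v and B v', for an edge e = {v, v'}, takes as argument a
   point indexed by e; thus no orientation of e has to be chosen. *)
definition S_op :: "('a \<Rightarrow> real set) \<Rightarrow> 'a set \<Rightarrow> 'a \<Rightarrow> ennreal \<Rightarrow> (('a \<Rightarrow> real) \<Rightarrow> real) \<Rightarrow> real \<Rightarrow> real" where
  "S_op B e v a f s = L_norm (lebesgue_on (B (other_end e v))) a (\<lambda>t. f (edge_point e v s t))"

definition mixed_norm :: "('a \<Rightarrow> real set) \<Rightarrow> 'a set \<Rightarrow> 'a \<Rightarrow> ennreal \<Rightarrow> (('a \<Rightarrow> real) \<Rightarrow> real) \<Rightarrow> real" where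
  "mixed_norm B e v a f = ess_sup_abs (lebesgue_on (B v)) (S_op B e v a f)"

definition edge_norm :: "('a \<Rightarrow> real set) \<Rightarrow> 'a set \<Rightarrow> ennreal \<Rightarrow> (('a \<Rightarrow> real) \<Rightarrow> real) \<Rightarrow> real" where
  "edge_norm B e a f = L_norm (box_measure B e) a f"

(* Unlike powr, this has 0 to the power 0 equal to 1. *)
definition rpow :: "real \<Rightarrow> real \<Rightarrow> real" where
  "rpow x p = (if p = 0 then 1 else x powr p)"

definition excess_ratio :: "real \<Rightarrow> real \<Rightarrow> real" where
  "excess_ratio w w' = (if w' = 0 \<and> w = 0 then 0 else (w' - w) / w')"

definition matching_ratio :: "real \<Rightarrow> real \<Rightarrow> real" where
  "matching_ratio w w' = (if w' = 0 \<and> w = 0 then 1 else w / w')"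

end

theory Submission
  imports Defs
begin

text \<open>Let \<open>T\<close> be the set of vertices whose \<open>w\<close>-degree is less than 1. By complementary slackness
  an edge with \<open>w' e > w e\<close> has one end in \<open>S'\<close> and the other in \<open>T\<close>; the vertices of \<open>T\<close> have
  \<open>w'\<close>-degree 1 and all others have \<open>w\<close>-degree 1. Put \<open>h e = \<bar>f e\<bar> powr (1 / w' e)\<close>. For fixed
  coordinates outside \<open>T\<close>, Finner's inequality with the weights \<open>w'\<close> integrates out the coordinates
  in \<open>T\<close> and leaves the product of \<open>H e powr w' e\<close>, where \<open>H e\<close> is the partial integral of \<open>h e\<close>.
  The factor \<open>H e powr (w' e - w e)\<close> is bounded by the mixed norm, and Finner's inequality with
  the weights \<open>w\<close> applies to the remaining factors \<open>H e powr w e\<close>.\<close>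

section \<open>Bounded nonnegative functions and Hoelder's inequality\<close>

text \<open>The bound holds at every point, not only almost everywhere, so the class is stable under
  measurable substitutions, in particular under fixing coordinates. Its members are integrable over
  finite measures, which settles the integrability conditions of Fubini's theorem.\<close>

definition bounded_nonneg :: "'b measure \<Rightarrow> ('b \<Rightarrow> real) \<Rightarrow> bool" where
  "bounded_nonneg N h \<longleftrightarrow> h \<in> borel_measurable N \<and> (\<exists>K. \<forall>x\<in>space N. 0 \<le> h x \<and> h x \<le> K)"

lemma bounded_nonneg_measurable: "bounded_nonneg N h \<Longrightarrow> h \<in> borel_measurable N"
  by (simp add: bounded_nonneg_def)

lemma bounded_nonneg_nonneg: "bounded_nonneg N h \<Longrightarrow> x \<in> space N \<Longrightarrow> 0 \<le> h x"
  by (auto simp: bounded_nonneg_def)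

lemma bounded_nonneg_integral_nonneg: "bounded_nonneg N h \<Longrightarrow> 0 \<le> (\<integral>x. h x \<partial>N)"
  by (simp add: bounded_nonneg_nonneg integral_nonneg_AE)

lemma bounded_nonneg_integrable:
  assumes "finite_measure N" "bounded_nonneg N h"
  shows "integrable N h"
proof -
  interpret finite_measure N by fact
  obtain K where "\<forall>x\<in>space N. 0 \<le> h x \<and> h x \<le> K"
    using assms(2) by (auto simp: bounded_nonneg_def)
  then show ?thesis
    using assms(2) by (intro integrable_const_bound[of _ K]) (auto simp: bounded_nonneg_def)
qed

lemma bounded_nonneg_powr:
  assumes "bounded_nonneg N h" "0 \<le> p"
  shows "bounded_nonneg N (\<lambda>x. h x powr p)"
proof -
  obtain K where K: "\<forall>x\<in>space N. 0 \<le> h x \<and> h x \<le> K"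
    using assms(1) by (auto simp: bounded_nonneg_def)
  have [measurable]: "h \<in> borel_measurable N"
    using assms(1) by (simp add: bounded_nonneg_def)
  have "\<forall>x\<in>space N. 0 \<le> h x powr p \<and> h x powr p \<le> K powr p"
    using K assms(2) by (auto intro: powr_mono2)
  then show ?thesis
    unfolding bounded_nonneg_def by (intro conjI exI[of _ "K powr p"]) auto
qed

lemma bounded_nonneg_const: "0 \<le> c \<Longrightarrow> bounded_nonneg N (\<lambda>x. c)"
  by (auto simp: bounded_nonneg_def)

lemma bounded_nonneg_mult:
  assumes "bounded_nonneg N g" "bounded_nonneg N h"
  shows "bounded_nonneg N (\<lambda>x. g x * h x)"
proof -
  obtain K where K: "\<forall>x\<in>space N. 0 \<le> g x \<and> g x \<le> K"
    using assms(1) by (auto simp: bounded_nonneg_def)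
  obtain L where L: "\<forall>x\<in>space N. 0 \<le> h x \<and> h x \<le> L"
    using assms(2) by (auto simp: bounded_nonneg_def)
  have [measurable]: "g \<in> borel_measurable N" "h \<in> borel_measurable N"
    using assms by (auto simp: bounded_nonneg_def)
  have "0 \<le> g x * h x \<and> g x * h x \<le> K * L" if "x \<in> space N" for x
    using K L that by (intro conjI mult_nonneg_nonneg mult_mono) (auto intro: order_trans)
  then show ?thesis
    unfolding bounded_nonneg_def by (intro conjI exI[of _ "K * L"]) auto
qed

lemma bounded_nonneg_prod:
  assumes "\<And>i. i \<in> I \<Longrightarrow> bounded_nonneg N (h i)"
  shows "bounded_nonneg N (\<lambda>x. \<Prod>i\<in>I. h i x)"
  using assms
  by (induction I rule: infinite_finite_induct) (auto intro: bounded_nonneg_mult bounded_nonneg_const)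

lemma bounded_nonneg_compose:
  assumes "bounded_nonneg N h" "g \<in> measurable M N"
  shows "bounded_nonneg M (\<lambda>x. h (g x))"
proof -
  have "h \<in> borel_measurable N"
    using assms(1) by (simp add: bounded_nonneg_def)
  from measurable_compose[OF assms(2) this] show ?thesis
    using assms measurable_space[OF assms(2)] by (auto simp: bounded_nonneg_def)
qed

lemma bounded_nonneg_integral:
  assumes "finite_measure M" "bounded_nonneg (N \<Otimes>\<^sub>M M) (\<lambda>z. f (fst z) (snd z))"
  shows "bounded_nonneg N (\<lambda>x. \<integral>y. f x y \<partial>M)"
proof -
  interpret finite_measure M by fact
  have f: "(\<lambda>z. f (fst z) (snd z)) \<in> borel_measurable (N \<Otimes>\<^sub>M M)"
    using assms(2) by (simp add: bounded_nonneg_def)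
  then have [measurable]: "case_prod f \<in> borel_measurable (N \<Otimes>\<^sub>M M)"
    by (simp add: case_prod_beta')
  obtain K where K: "\<forall>z\<in>space (N \<Otimes>\<^sub>M M). 0 \<le> f (fst z) (snd z) \<and> f (fst z) (snd z) \<le> K"
    using assms(2) by (auto simp: bounded_nonneg_def)
  have *: "0 \<le> (\<integral>y. f x y \<partial>M) \<and> (\<integral>y. f x y \<partial>M) \<le> K * measure M (space M)"
    if "x \<in> space N" for x
  proof -
    have b: "0 \<le> f x y \<and> f x y \<le> K" if "y \<in> space M" for y
      using K that \<open>x \<in> space N\<close> by (auto simp: space_pair_measure)
    then have "bounded_nonneg M (f x)"
      using f \<open>x \<in> space N\<close> by (auto simp: bounded_nonneg_def)
    then have "integrable M (f x)"
      using assms(1) by (rule bounded_nonneg_integrable[rotated])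
    then have "(\<integral>y. f x y \<partial>M) \<le> (\<integral>y. K \<partial>M)"
      using b by (intro integral_mono) auto
    moreover have "0 \<le> (\<integral>y. f x y \<partial>M)"
      using b by (intro Bochner_Integration.integral_nonneg) auto
    ultimately show ?thesis by (simp add: mult.commute)
  qed
  have "(\<lambda>x. \<integral>y. f x y \<partial>M) \<in> borel_measurable N"
    by measurable
  with * show ?thesis unfolding bounded_nonneg_def by blast
qed

text \<open>Jensen's inequality for the exponential function at the points \<open>ln (x i)\<close>.
  A vanishing \<open>x i\<close> makes the left side 0 and is treated first.\<close>

lemma weighted_arith_geo_mean:
  fixes x p :: "'i \<Rightarrow> real"
  assumes "finite I" "\<And>i. i \<in> I \<Longrightarrow> 0 < p i" "(\<Sum>i\<in>I. p i) = 1" "\<And>i. i \<in> I \<Longrightarrow> 0 \<le> x i"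
  shows "(\<Prod>i\<in>I. x i powr p i) \<le> (\<Sum>i\<in>I. p i * x i)"
proof (cases "\<exists>i\<in>I. x i = 0")
  case True
  then have "(\<Prod>i\<in>I. x i powr p i) = 0"
    using assms(1) by auto
  also have "\<dots> \<le> (\<Sum>i\<in>I. p i * x i)"
    using assms by (intro sum_nonneg) (simp add: less_imp_le)
  finally show ?thesis .
next
  case False
  then have pos: "0 < x i" if "i \<in> I" for i
    using assms(4) that by force
  have "I \<noteq> {}" using assms(3) by auto
  have "(\<Prod>i\<in>I. x i powr p i) = exp (\<Sum>i\<in>I. p i * ln (x i))"
    using assms(1) by (subst exp_sum) (auto simp: powr_def dest: pos intro!: prod.cong)
  also have "\<dots> \<le> (\<Sum>i\<in>I. p i * exp (ln (x i)))"
    using convex_on_sum[OF assms(1) \<open>I \<noteq> {}\<close> exp_convex assms(3), of "\<lambda>i. ln (x i)"] assms(2)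
    by (simp add: less_imp_le)
  also have "\<dots> = (\<Sum>i\<in>I. p i * x i)"
    using pos by (intro sum.cong) auto
  finally show ?thesis .
qed

text \<open>Each \<open>h i\<close> is divided by its integral \<open>a i\<close>; the weighted mean
  inequality is applied pointwise, and the resulting sum integrates to the sum of the
  \<open>p i\<close>, which is 1. If some \<open>a i\<close> is 0, then \<open>h i\<close> vanishes
  almost everywhere, and so does the product.\<close>

lemma Hoelder_integral_prod:
  fixes h :: "'i \<Rightarrow> 'b \<Rightarrow> real"
  assumes N: "finite_measure N" and I: "finite I"
    and p: "\<And>i. i \<in> I \<Longrightarrow> 0 < p i" "(\<Sum>i\<in>I. p i) = 1"
    and h: "\<And>i. i \<in> I \<Longrightarrow> bounded_nonneg N (h i)"
  shows "(\<integral>x. (\<Prod>i\<in>I. h i x powr p i) \<partial>N) \<le> (\<Prod>i\<in>I. (\<integral>x. h i x \<partial>N) powr p i)"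
proof -
  define a where "a i = (\<integral>x. h i x \<partial>N)" for i
  have int: "integrable N (h i)" if "i \<in> I" for i
    using that h N bounded_nonneg_integrable by blast
  have a0: "0 \<le> a i" if "i \<in> I" for i
    unfolding a_def using h that by (simp add: bounded_nonneg_integral_nonneg)
  show ?thesis
  proof (cases "\<exists>i\<in>I. a i = 0")
    case True
    then obtain i where i: "i \<in> I" "a i = 0" by blast
    then have "AE x in N. h i x = 0"
      using integral_nonneg_eq_0_iff_AE[OF int[OF i(1)]] h[OF i(1)]
      by (auto simp: a_def bounded_nonneg_def)
    then have "AE x in N. (\<Prod>i\<in>I. h i x powr p i) = 0"
      using I i by (auto elim: eventually_mono)
    then have "(\<integral>x. (\<Prod>i\<in>I. h i x powr p i) \<partial>N) = 0"
      by (rule integral_eq_zero_AE)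
    then show ?thesis by (simp add: prod_nonneg)
  next
    case False
    then have pos: "0 < a i" if "i \<in> I" for i
      using a0 that by force
    have scale: "(\<Prod>i\<in>I. h i x powr p i) \<le> (\<Prod>i\<in>I. a i powr p i) * (\<Sum>i\<in>I. p i * (h i x / a i))"
      if "x \<in> space N" for x
    proof -
      have nn: "0 \<le> h i x" if "i \<in> I" for i
        using h that \<open>x \<in> space N\<close> by (auto simp: bounded_nonneg_def)
      have "(\<Prod>i\<in>I. h i x powr p i) = (\<Prod>i\<in>I. a i powr p i * (h i x / a i) powr p i)"
      proof (rule prod.cong)
        fix i assume "i \<in> I"
        then show "h i x powr p i = a i powr p i * (h i x / a i) powr p i"
          using pos[of i] nn[of i] by (simp add: powr_divide)
      qed simp
      also have "\<dots> = (\<Prod>i\<in>I. a i powr p i) * (\<Prod>i\<in>I. (h i x / a i) powr p i)"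
        by (rule prod.distrib)
      also have "\<dots> \<le> (\<Prod>i\<in>I. a i powr p i) * (\<Sum>i\<in>I. p i * (h i x / a i))"
        using I p nn a0 by (intro mult_left_mono weighted_arith_geo_mean) (auto intro: prod_nonneg)
      finally show ?thesis .
    qed
    have "(\<integral>x. (\<Prod>i\<in>I. h i x powr p i) \<partial>N)
        \<le> (\<integral>x. (\<Prod>i\<in>I. a i powr p i) * (\<Sum>i\<in>I. p i * (h i x / a i)) \<partial>N)"
    proof (rule integral_mono)
      show "integrable N (\<lambda>x. \<Prod>i\<in>I. h i x powr p i)"
        using h p
        by (intro bounded_nonneg_integrable[OF N] bounded_nonneg_prod bounded_nonneg_powr)
           (auto simp: less_imp_le)
    qed (use scale int in auto)
    also have "\<dots> = (\<Prod>i\<in>I. a i powr p i) * (\<Sum>i\<in>I. p i * (a i / a i))"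
      using int by (simp add: a_def del: divide_self_if)
    also have "\<dots> = (\<Prod>i\<in>I. a i powr p i)"
    proof -
      have "(\<Sum>i\<in>I. p i * (a i / a i)) = (\<Sum>i\<in>I. p i)"
        by (intro sum.cong) (auto dest: pos)
      then show ?thesis using p by simp
    qed
    finally show ?thesis unfolding a_def .
  qed
qed

section \<open>Finner's inequality\<close>

locale product_finite_measure = product_sigma_finite M for M :: "'i \<Rightarrow> 'b measure" +
  assumes finite_measures: "finite_measure (M i)"
begin

lemma finite_measure_PiM:
  assumes "finite I"
  shows "finite_measure (PiM I M)"
proof (rule finite_measureI)
  have "emeasure (PiM I M) (space (PiM I M)) = (\<Prod>i\<in>I. emeasure (M i) (space (M i)))"
    using assms by (simp add: space_PiM emeasure_PiM)
  also have "\<dots> < \<infinity>"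
    using finite_measure.emeasure_finite[OF finite_measures] assms
    by (simp add: ennreal_prod_eq_top less_top[symmetric])
  finally show "emeasure (PiM I M) (space (PiM I M)) \<noteq> \<infinity>" by simp
qed

lemma bounded_nonneg_restrict:
  assumes "bounded_nonneg (PiM A M) h" "A \<subseteq> I"
  shows "bounded_nonneg (PiM I M) (\<lambda>x. h (restrict x A))"
  using assms by (rule bounded_nonneg_compose[OF _ measurable_restrict_subset])

text \<open>Integrating out one coordinate \<open>v\<close> by Hoelder's inequality replaces
  \<open>A j\<close> by \<open>A j - {v}\<close> and keeps the weights and the degree condition at
  the other coordinates; hence the induction generalises \<open>A\<close> and \<open>h\<close>. The
  sets have an index of their own because different edges may have the same intersection with
  \<open>T\<close>.\<close>

lemma Finner_inequality:
  fixes A :: "'j \<Rightarrow> 'i set"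
  assumes "finite V" "finite J"
    and "\<And>j. j \<in> J \<Longrightarrow> A j \<subseteq> V"
    and "\<And>j. j \<in> J \<Longrightarrow> 0 < p j"
    and "\<And>v. v \<in> V \<Longrightarrow> (\<Sum>j | j \<in> J \<and> v \<in> A j. p j) = 1"
    and "\<And>j. j \<in> J \<Longrightarrow> bounded_nonneg (PiM (A j) M) (h j)"
  shows "(\<integral>x. (\<Prod>j\<in>J. h j (restrict x (A j)) powr p j) \<partial>PiM V M)
    \<le> (\<Prod>j\<in>J. (\<integral>x. h j x \<partial>PiM (A j) M) powr p j)"
  using assms(1,3,5,6)
proof (induction V arbitrary: A h)
  case empty
  then have "A j = {}" if "j \<in> J" for j using that by simp
  \<comment> \<open>The product measure over no coordinates is the unit mass at one point, so both
    sides reduce to the same product of values.\<close>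
  then have "(\<Prod>j\<in>J. h j (restrict x (A j)) powr p j) = (\<Prod>j\<in>J. h j (\<lambda>_. undefined) powr p j)"
    "(\<Prod>j\<in>J. (\<integral>x. h j x \<partial>PiM (A j) M) powr p j) = (\<Prod>j\<in>J. h j (\<lambda>_. undefined) powr p j)" for x
    by (auto simp: restrict_def PiM_empty lebesgue_integral_count_space_finite intro!: prod.cong)
  then show ?case by (simp add: PiM_empty lebesgue_integral_count_space_finite)
next
  case (insert v V)
  interpret Mv: finite_measure "M v" by (rule finite_measures)
  interpret PV: finite_measure "PiM V M" by (rule finite_measure_PiM) fact
  define A' where "A' j = A j - {v}" for j
  \<comment> \<open>A factor that does not depend on \<open>v\<close> is kept as it is: integrating
    it would bring in the mass of \<open>M v\<close>, which may differ from 1.\<close>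
  define h' where "h' j = (if v \<in> A j then (\<lambda>x. \<integral>y. h j (x(v := y)) \<partial>M v) else h j)" for j
  have A: "A j \<subseteq> insert v V" "finite (A j)" if "j \<in> J" for j
    using insert.prems(1)[OF that] insert.hyps(1) by (auto intro: finite_subset)
  have ins: "insert v (A' j) = A j" if "v \<in> A j" for j
    using that by (auto simp: A'_def)
  have bh: "bounded_nonneg (PiM (A j) M) (h j)" if "j \<in> J" for j
    using insert.prems(3) that .
  have bh': "bounded_nonneg (PiM (A' j) M) (h' j)" if "j \<in> J" for j
  proof (cases "v \<in> A j")
    case True
    have "bounded_nonneg (PiM (A' j) M \<Otimes>\<^sub>M M v) (\<lambda>z. h j ((fst z)(v := snd z)))"
    proof (rule bounded_nonneg_compose[OF bh[OF that]])
      show "(\<lambda>z. (fst z)(v := snd z)) \<in> PiM (A' j) M \<Otimes>\<^sub>M M v \<rightarrow>\<^sub>M PiM (A j) M"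
        using measurable_add_dim[of v "A' j" M] ins[OF True] by (simp add: case_prod_beta')
    qed
    then show ?thesis
      using True by (simp add: h'_def bounded_nonneg_integral[OF finite_measures])
  next
    case False
    then show ?thesis using bh[OF that] by (simp add: h'_def A'_def)
  qed
  have int': "(\<integral>x. h' j x \<partial>PiM (A' j) M) = (\<integral>x. h j x \<partial>PiM (A j) M)" if "j \<in> J" for j
  proof (cases "v \<in> A j")
    case True
    have "integrable (PiM (insert v (A' j)) M) (h j)"
      using bh[OF that] A(2)[OF that] ins[OF True] finite_measure_PiM bounded_nonneg_integrable
      by metis
    then show ?thesis
      using True A(2)[OF that] product_integral_insert[of "A' j" v "h j"] ins[OF True]
      by (simp add: h'_def A'_def)
  qed (simp add: h'_def A'_def)
  have bF: "bounded_nonneg (PiM (insert v V) M) (\<lambda>x. \<Prod>j\<in>J. h j (restrict x (A j)) powr p j)"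
    using bh A assms(4)
    by (intro bounded_nonneg_prod bounded_nonneg_powr bounded_nonneg_restrict) (auto simp: less_imp_le)
  have bF': "bounded_nonneg (PiM V M) (\<lambda>x. \<Prod>j\<in>J. h' j (restrict x (A' j)) powr p j)"
    using bh' A assms(4)
    by (intro bounded_nonneg_prod bounded_nonneg_powr bounded_nonneg_restrict) (auto simp: less_imp_le A'_def)
  have step: "(\<integral>y. (\<Prod>j\<in>J. h j (restrict (x(v := y)) (A j)) powr p j) \<partial>M v)
      \<le> (\<Prod>j\<in>J. h' j (restrict x (A' j)) powr p j)" if x: "x \<in> space (PiM V M)" for x
  proof -
    let ?J1 = "{j \<in> J. v \<notin> A j}" and ?J2 = "{j \<in> J. v \<in> A j}"
    have split: "(\<Prod>j\<in>J. g j) = (\<Prod>j\<in>?J1. g j) * (\<Prod>j\<in>?J2. g j)" for g :: "'j \<Rightarrow> real"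
      using assms(2) by (subst prod.union_disjoint[symmetric]) (auto intro: prod.cong)
    have r1: "restrict (x(v := y)) (A j) = restrict x (A' j)" if "v \<notin> A j" for j y
      using that by (auto simp: A'_def restrict_def fun_eq_iff)
    have r2: "restrict (x(v := y)) (A j) = (restrict x (A' j))(v := y)" if "v \<in> A j" for j y
      using that by (auto simp: A'_def restrict_def fun_eq_iff)
    have b2: "bounded_nonneg (M v) (\<lambda>y. h j ((restrict x (A' j))(v := y)))" if "j \<in> ?J2" for j
    proof (rule bounded_nonneg_compose[OF bh])
      have "restrict x (A' j) \<in> space (PiM (A' j) M)"
        using x A(1)[of j] that by (auto simp: space_PiM A'_def)
      then have "(\<lambda>y. (restrict x (A' j))(v := y)) \<in> M v \<rightarrow>\<^sub>M PiM (insert v (A' j)) M"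
        by (rule measurable_component_update) (simp add: A'_def)
      then show "(\<lambda>y. (restrict x (A' j))(v := y)) \<in> M v \<rightarrow>\<^sub>M PiM (A j) M"
        using that ins[of j] by simp
    qed (use that in auto)
    have "(\<integral>y. (\<Prod>j\<in>J. h j (restrict (x(v := y)) (A j)) powr p j) \<partial>M v)
      = (\<Prod>j\<in>?J1. h j (restrict x (A' j)) powr p j) *
        (\<integral>y. (\<Prod>j\<in>?J2. h j ((restrict x (A' j))(v := y)) powr p j) \<partial>M v)"
    proof -
      have "(\<Prod>j\<in>?J1. h j (restrict (x(v := y)) (A j)) powr p j)
          = (\<Prod>j\<in>?J1. h j (restrict x (A' j)) powr p j)" for y
        by (intro prod.cong refl arg_cong2[where f = "(powr)"] arg_cong[where f = "h _"] r1) auto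
      moreover have "(\<Prod>j\<in>?J2. h j (restrict (x(v := y)) (A j)) powr p j)
          = (\<Prod>j\<in>?J2. h j ((restrict x (A' j))(v := y)) powr p j)" for y
        by (intro prod.cong refl arg_cong2[where f = "(powr)"] arg_cong[where f = "h _"] r2) auto
      ultimately show ?thesis by (simp only: split integral_mult_right_zero)
    qed
    \<comment> \<open>The degree condition at \<open>v\<close> says that the weights of the factors
      in \<open>?J2\<close> sum to 1, as Hoelder's inequality requires.\<close>
    also have "\<dots> \<le> (\<Prod>j\<in>?J1. h j (restrict x (A' j)) powr p j) *
        (\<Prod>j\<in>?J2. (\<integral>y. h j ((restrict x (A' j))(v := y)) \<partial>M v) powr p j)"
      using assms(2,4) b2 insert.prems(2)[of v]
      by (intro mult_left_mono Hoelder_integral_prod finite_measures) (auto intro: prod_nonneg)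
    also have "\<dots> = (\<Prod>j\<in>J. h' j (restrict x (A' j)) powr p j)"
    proof -
      have "(\<Prod>j\<in>?J1. h j (restrict x (A' j)) powr p j) = (\<Prod>j\<in>?J1. h j (restrict x (A j)) powr p j)"
        by (intro prod.cong) (auto simp: A'_def)
      then show ?thesis by (simp add: split h'_def)
    qed
    finally show ?thesis .
  qed
  have "(\<integral>x. (\<Prod>j\<in>J. h j (restrict x (A j)) powr p j) \<partial>PiM (insert v V) M)
    = (\<integral>x. (\<integral>y. (\<Prod>j\<in>J. h j (restrict (x(v := y)) (A j)) powr p j) \<partial>M v) \<partial>PiM V M)"
    using insert.hyps bF
    by (intro product_integral_insert bounded_nonneg_integrable finite_measure_PiM) auto
  also have "\<dots> \<le> (\<integral>x. (\<Prod>j\<in>J. h' j (restrict x (A' j)) powr p j) \<partial>PiM V M)"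
    using step bounded_nonneg_integrable[OF PV.finite_measure_axioms bF'] 
    by (intro integral_mono') (auto intro: prod_nonneg)
  also have "\<dots> \<le> (\<Prod>j\<in>J. (\<integral>x. h' j x \<partial>PiM (A' j) M) powr p j)"
  proof (rule insert.IH)
    show "A' j \<subseteq> V" if "j \<in> J" for j
      using A(1)[OF that] by (auto simp: A'_def)
    show "(\<Sum>j | j \<in> J \<and> u \<in> A' j. p j) = 1" if "u \<in> V" for u
    proof -
      have "u \<noteq> v" using that insert.hyps(2) by auto
      then show ?thesis using insert.prems(2)[of u] that by (simp add: A'_def)
    qed
  qed (rule bh')
  also have "\<dots> = (\<Prod>j\<in>J. (\<integral>x. h j x \<partial>PiM (A j) M) powr p j)"
    using int' by simp
  finally show ?case .
qed

text \<open>\<open>PiM I M\<close> is the image under \<open>merge\<close> of the product of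
  \<open>PiM A M\<close> and \<open>PiM (I - A) M\<close>, and a null set of the first factor stays
  null in that product.\<close>

lemma AE_PiM_restrict:
  assumes "finite I" "A \<subseteq> I" "AE y in PiM A M. P y"
  shows "AE x in PiM I M. P (restrict x A)"
proof -
  have fin: "finite A" "finite (I - A)" using assms(1,2) by (auto intro: finite_subset)
  interpret B: pair_sigma_finite "PiM A M" "PiM (I - A) M"
    using fin by (intro pair_sigma_finite.intro sigma_finite)
  \<comment> \<open>The exceptional set of \<open>P\<close> may be non-measurable, so a measurable
    null set containing it is carried through the image measure.\<close>
  obtain N where N: "N \<in> null_sets (PiM A M)" "{y \<in> space (PiM A M). \<not> P y} \<subseteq> N"
    using assms(3) by (auto elim: AE_E simp: null_sets_def)
  have [measurable]: "N \<in> sets (PiM A M)" using N(1) by auto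
  have I: "A \<union> (I - A) = I" using assms(2) by auto
  have [measurable]: "(\<lambda>x. restrict x A) \<in> PiM I M \<rightarrow>\<^sub>M PiM A M"
    by (rule measurable_restrict_subset[OF assms(2)])
  have [measurable]: "merge A (I - A) \<in> PiM A M \<Otimes>\<^sub>M PiM (I - A) M \<rightarrow>\<^sub>M PiM I M"
    using measurable_merge[of A "I - A" M] I by simp
  have "AE w in PiM A M \<Otimes>\<^sub>M PiM (I - A) M. fst w \<notin> N"
    using AE_not_in[OF N(1)] by (intro B.AE_pair_measure) auto
  then have "AE w in PiM A M \<Otimes>\<^sub>M PiM (I - A) M. restrict (merge A (I - A) w) A \<notin> N"
  proof (rule AE_mp, intro AE_I2 impI)
    fix w assume "w \<in> space (PiM A M \<Otimes>\<^sub>M PiM (I - A) M)" "fst w \<notin> N"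
    moreover from this have "restrict (merge A (I - A) w) A = fst w"
      by (cases w) (auto simp: space_pair_measure space_PiM PiE_def extensional_restrict)
    ultimately show "restrict (merge A (I - A) w) A \<notin> N" by simp
  qed
  then have "AE x in distr (PiM A M \<Otimes>\<^sub>M PiM (I - A) M) (PiM I M) (merge A (I - A)). restrict x A \<notin> N"
    by (subst AE_distr_iff) (auto simp: measurable_restrict_subset)
  then have "AE x in PiM I M. restrict x A \<notin> N"
    unfolding distr_merge[of A "I - A", OF Diff_disjoint fin, unfolded I] .
  then show ?thesis
  proof (rule AE_mp, intro AE_I2 impI)
    fix x assume "x \<in> space (PiM I M)" "restrict x A \<notin> N"
    moreover from this have "restrict x A \<in> space (PiM A M)"
      using assms(2) by (auto simp: space_PiM)
    ultimately show "P (restrict x A)" using N(2) by auto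
  qed
qed

text \<open>The exponent \<open>q e\<close> is split as \<open>(q e - p e) + p e\<close>: the first
  part is absorbed by \<open>C e\<close>, the second is left for Finner's inequality off
  \<open>T\<close>. Both products on the right omit zero exponents, because \<open>0 powr 0\<close>
  is 0 and Finner's inequality asks for positive weights.\<close>

lemma two_stage_Finner_inequality:
  fixes h :: "'i set \<Rightarrow> ('i \<Rightarrow> 'b) \<Rightarrow> real"
  assumes V: "finite V" "T \<subseteq> V" and E: "finite E" "\<And>e. e \<in> E \<Longrightarrow> e \<subseteq> V"
    and p: "\<And>e. e \<in> E \<Longrightarrow> 0 \<le> p e" "\<And>e. e \<in> E \<Longrightarrow> p e \<le> q e" "\<And>e. e \<in> E \<Longrightarrow> 0 < q e"
    and T: "\<And>v. v \<in> T \<Longrightarrow> (\<Sum>e | e \<in> E \<and> v \<in> e. q e) = 1"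
    and VT: "\<And>v. v \<in> V - T \<Longrightarrow> (\<Sum>e | e \<in> E \<and> v \<in> e. p e) = 1"
    and h: "\<And>e. e \<in> E \<Longrightarrow> bounded_nonneg (PiM e M) (h e)"
    and C: "\<And>e. e \<in> E \<Longrightarrow> p e < q e \<Longrightarrow>
      AE y in PiM (e - T) M. (\<integral>z. h e (merge (e - T) (e \<inter> T) (y, z)) \<partial>PiM (e \<inter> T) M) \<le> C e"
  shows "(\<integral>x. (\<Prod>e\<in>E. h e (restrict x e) powr q e) \<partial>PiM V M)
    \<le> (\<Prod>e | e \<in> E \<and> p e < q e. C e powr (q e - p e))
      * (\<Prod>e | e \<in> E \<and> 0 < p e. (\<integral>x. h e x \<partial>PiM e M) powr p e)"
proof -
  \<comment> \<open>Either index set may be empty: for \<open>e\<close> disjoint from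
    \<open>T\<close>, \<open>H e\<close> agrees with \<open>h e\<close> on the space, and for
    \<open>e\<close> inside \<open>T\<close> it is constant.\<close>
  define H where "H e y = (\<integral>z. h e (merge (e - T) (e \<inter> T) (y, z)) \<partial>PiM (e \<inter> T) M)" for e y
  have finT: "finite T" "finite (V - T)" using V by (auto intro: finite_subset)
  have fe: "finite (e - T)" "finite (e \<inter> T)" if "e \<in> E" for e
    using E(2)[OF that] V(1) by (auto intro: finite_subset)
  have un: "(e - T) \<union> (e \<inter> T) = e" for e by auto
  have bm: "bounded_nonneg (PiM (e - T) M \<Otimes>\<^sub>M PiM (e \<inter> T) M)
      (\<lambda>w. h e (merge (e - T) (e \<inter> T) w))" if "e \<in> E" for e
    using measurable_merge[of "e - T" "e \<inter> T" M] un[of e]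
    by (intro bounded_nonneg_compose[OF h[OF that]]) simp
  have bH: "bounded_nonneg (PiM (e - T) M) (H e)" if "e \<in> E" for e
    unfolding H_def using bm[OF that]
    by (intro bounded_nonneg_integral finite_measure_PiM fe that) simp
  have bs: "bounded_nonneg (PiM (e \<inter> T) M) (\<lambda>z. h e (merge (e - T) (e \<inter> T) (y, z)))"
    if "e \<in> E" "y \<in> space (PiM (e - T) M)" for e y
    using that by (intro bounded_nonneg_compose[OF bm]) auto
  have intH: "(\<integral>y. H e y \<partial>PiM (e - T) M) = (\<integral>x. h e x \<partial>PiM e M)" if "e \<in> E" for e
  proof -
    have "finite e" using E(2)[OF that] V(1) by (rule finite_subset)
    then have "integrable (PiM ((e - T) \<union> (e \<inter> T)) M) (h e)"
      unfolding un by (intro bounded_nonneg_integrable finite_measure_PiM h that)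
    moreover have "(e - T) \<inter> (e \<inter> T) = {}" by auto
    ultimately show ?thesis
      using product_integral_fold[of "e - T" "e \<inter> T" "h e"] fe[OF that]
      unfolding un H_def by simp
  qed
  define F where "F x = (\<Prod>e\<in>E. h e (restrict x e) powr q e)" for x
  have bF: "bounded_nonneg (PiM V M) F"
    unfolding F_def using h E p
    by (intro bounded_nonneg_prod bounded_nonneg_powr bounded_nonneg_restrict) (auto simp: less_imp_le)
  have H_nonneg: "0 \<le> H e (restrict x (e - T))" if "e \<in> E" "x \<in> space (PiM (V - T) M)" for e x
    using that E(2)[OF that(1)]
    by (intro bounded_nonneg_nonneg[OF bH]) (auto simp: space_PiM)
  have stage1: "(\<integral>z. F (merge (V - T) T (x, z)) \<partial>PiM T M)
      \<le> (\<Prod>e\<in>E. H e (restrict x (e - T)) powr q e)" if x: "x \<in> space (PiM (V - T) M)" for x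
  proof -
    \<comment> \<open>For fixed \<open>x\<close>, the factor of \<open>e\<close> thus depends on
      \<open>z\<close> only through the coordinates in \<open>e \<inter> T\<close>, the form that
      Finner's inequality over \<open>T\<close> expects.\<close>
    have r: "restrict (merge (V - T) T (x, z)) e
        = merge (e - T) (e \<inter> T) (restrict x (e - T), restrict z (e \<inter> T))" if "e \<in> E" for e z
      using E(2)[OF that] by (auto simp: fun_eq_iff merge_def restrict_def)
    have "(\<integral>z. F (merge (V - T) T (x, z)) \<partial>PiM T M) =
      (\<integral>z. (\<Prod>e\<in>E. h e (merge (e - T) (e \<inter> T) (restrict x (e - T), restrict z (e \<inter> T))) powr q e) \<partial>PiM T M)"
      unfolding F_def using r by (intro Bochner_Integration.integral_cong prod.cong) auto
    also have "\<dots> \<le> (\<Prod>e\<in>E. (\<integral>z. h e (merge (e - T) (e \<inter> T) (restrict x (e - T), z)) \<partial>PiM (e \<inter> T) M) powr q e)"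
    proof (rule Finner_inequality[OF finT(1) E(1)])
      show "(\<Sum>e | e \<in> E \<and> v \<in> e \<inter> T. q e) = 1" if "v \<in> T" for v
        using T[OF that] that by simp
      show "bounded_nonneg (PiM (e \<inter> T) M) (\<lambda>z. h e (merge (e - T) (e \<inter> T) (restrict x (e - T), z)))"
        if "e \<in> E" for e
        using x E(2)[OF that] by (intro bs that) (auto simp: space_PiM)
    qed (use p in auto)
    finally show ?thesis unfolding H_def .
  qed
  define K where "K = (\<Prod>e | e \<in> E \<and> p e < q e. C e powr (q e - p e))"
  define G where "G x = (\<Prod>e | e \<in> E \<and> 0 < p e. H e (restrict x (e - T)) powr p e)" for x
  \<comment> \<open>The exceptional null sets live in different coordinate spaces; pulled back to
    \<open>V - T\<close>, finitely many of them can be united.\<close>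
  have "AE x in PiM (V - T) M. \<forall>e\<in>{e \<in> E. p e < q e}. H e (restrict x (e - T)) \<le> C e"
  proof (rule AE_finite_allI)
    fix e assume e: "e \<in> {e \<in> E. p e < q e}"
    then have "AE y in PiM (e - T) M. H e y \<le> C e"
      using C unfolding H_def by auto
    then show "AE x in PiM (V - T) M. H e (restrict x (e - T)) \<le> C e"
      using finT E(2) e by (intro AE_PiM_restrict) auto
  qed (use E in auto)
  then have bound: "AE x in PiM (V - T) M. (\<Prod>e\<in>E. H e (restrict x (e - T)) powr q e) \<le> K * G x"
  proof (rule AE_mp, intro AE_I2 impI)
    fix x assume x: "x \<in> space (PiM (V - T) M)"
      and le: "\<forall>e\<in>{e \<in> E. p e < q e}. H e (restrict x (e - T)) \<le> C e"
    have "(\<Prod>e\<in>E. H e (restrict x (e - T)) powr q e)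
      \<le> (\<Prod>e\<in>E. (if p e < q e then C e powr (q e - p e) else 1)
          * (if 0 < p e then H e (restrict x (e - T)) powr p e else 1))"
    proof (intro prod_mono conjI)
      fix e assume e: "e \<in> E"
      let ?H = "H e (restrict x (e - T))"
      note H0 = H_nonneg[OF e x]
      \<comment> \<open>If \<open>p e = 0\<close>, the whole power is absorbed by
        \<open>C e\<close>; if \<open>p e = q e\<close>, none of it is.\<close>
      show "?H powr q e \<le> (if p e < q e then C e powr (q e - p e) else 1)
          * (if 0 < p e then ?H powr p e else 1)"
      proof (cases "p e < q e")
        case True
        then have Hle: "?H powr (q e - p e) \<le> C e powr (q e - p e)"
          using le e H0 by (intro powr_mono2) auto
        show ?thesis
        proof (cases "p e = 0")
          case True
          then show ?thesis using \<open>p e < q e\<close> Hle by simp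
        next
          case False
          then have "0 < p e" using p(1)[OF e] by simp
          have "?H powr q e = ?H powr (q e - p e) * ?H powr p e"
            using powr_add[of ?H "q e - p e" "p e"] by simp
          also have "\<dots> \<le> C e powr (q e - p e) * ?H powr p e"
            using Hle by (rule mult_right_mono) simp
          finally show ?thesis using \<open>p e < q e\<close> \<open>0 < p e\<close> by simp
        qed
      next
        case False
        then have "p e = q e" using p(2)[OF e] by simp
        then show ?thesis using p(3)[OF e] by simp
      qed
    qed simp
    also have "\<dots> = K * G x"
      using E(1) by (simp add: prod.distrib K_def G_def prod.inter_filter)
    finally show "(\<Prod>e\<in>E. H e (restrict x (e - T)) powr q e) \<le> K * G x" .
  qed
  have "bounded_nonneg (PiM (V - T) M) G"
    unfolding G_def using bH E(2) p
    by (intro bounded_nonneg_prod bounded_nonneg_powr bounded_nonneg_restrict) auto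
  then have bG: "integrable (PiM (V - T) M) G"
    by (intro bounded_nonneg_integrable finite_measure_PiM finT)
  have G0: "0 \<le> G x" for x unfolding G_def by (simp add: prod_nonneg)
  have K0: "0 \<le> K" unfolding K_def by (simp add: prod_nonneg)
  have "(\<integral>x. F x \<partial>PiM V M) = (\<integral>x. (\<integral>z. F (merge (V - T) T (x, z)) \<partial>PiM T M) \<partial>PiM (V - T) M)"
  proof -
    have "V - T \<union> T = V" using V(2) by auto
    then show ?thesis
      using product_integral_fold[of "V - T" T F] finT bF
        bounded_nonneg_integrable[OF finite_measure_PiM[OF V(1)]] by auto
  qed
  also have "\<dots> \<le> (\<integral>x. K * G x \<partial>PiM (V - T) M)"
  proof (rule integral_mono_AE')
    show "AE x in PiM (V - T) M. (\<integral>z. F (merge (V - T) T (x, z)) \<partial>PiM T M) \<le> K * G x"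
      using bound by (rule AE_mp) (auto intro!: AE_I2 intro: order_trans[OF stage1])
  qed (use bG G0 K0 in auto)
  also have "\<dots> = K * (\<integral>x. G x \<partial>PiM (V - T) M)" by simp
  also have "\<dots> \<le> K * (\<Prod>e | e \<in> E \<and> 0 < p e. (\<integral>y. H e y \<partial>PiM (e - T) M) powr p e)"
    unfolding G_def
  proof (intro mult_left_mono K0 Finner_inequality)
    \<comment> \<open>Edges with \<open>p e = 0\<close> add nothing to a degree, so
      \<open>VT\<close> survives their removal.\<close>
    show "(\<Sum>e | e \<in> {e \<in> E. 0 < p e} \<and> v \<in> e - T. p e) = 1" if "v \<in> V - T" for v
    proof -
      have "(\<Sum>e | e \<in> {e \<in> E. 0 < p e} \<and> v \<in> e - T. p e) = (\<Sum>e | e \<in> E \<and> v \<in> e. p e)"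
        using E(1) that p(1) by (intro sum.mono_neutral_left) (auto simp: order.order_iff_strict)
      then show ?thesis using VT[OF that] by simp
    qed
  qed (use finT E bH in auto)
  finally show ?thesis
    using intH by (simp add: F_def K_def)
qed

end

section \<open>Complementary slackness\<close>

abbreviation weighted_degree :: "'a set set \<Rightarrow> ('a set \<Rightarrow> real) \<Rightarrow> 'a \<Rightarrow> real" where
  "weighted_degree E w v \<equiv> \<Sum>e | e \<in> E \<and> v \<in> e. w e"

lemma simple_graph_finite_edges: "simple_graph V E \<Longrightarrow> finite E"
  unfolding simple_graph_def by (rule finite_subset[of _ "Pow V"]) auto

text \<open>Double counting of incidences weighted by \<open>c\<close>; the duality between vertex
  covers and edge weightings rests on it.\<close>

lemma sum_weighted_degree:
  fixes c :: "'a \<Rightarrow> real"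
  assumes "simple_graph V E"
  shows "(\<Sum>v\<in>V. c v * weighted_degree E w v) = (\<Sum>e\<in>E. w e * (\<Sum>v\<in>e. c v))"
proof -
  note E = simple_graph_finite_edges[OF assms]
  have V: "finite V" "\<And>e. e \<in> E \<Longrightarrow> e \<subseteq> V" using assms by (auto simp: simple_graph_def)
  have "(\<Sum>v\<in>V. c v * weighted_degree E w v) = (\<Sum>v\<in>V. \<Sum>e\<in>E. if v \<in> e then w e * c v else 0)"
    using E by (simp add: sum_distrib_left sum.inter_filter if_distrib mult.commute cong: if_cong)
  also have "\<dots> = (\<Sum>e\<in>E. \<Sum>v\<in>V. if v \<in> e then w e * c v else 0)"
    by (rule sum.swap)
  also have "\<dots> = (\<Sum>e\<in>E. w e * (\<Sum>v\<in>e. c v))"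
  proof (rule sum.cong)
    fix e assume "e \<in> E"
    then have "{v \<in> V. v \<in> e} = e" using V(2) by auto
    then show "(\<Sum>v\<in>V. if v \<in> e then w e * c v else 0) = w e * (\<Sum>v\<in>e. c v)"
      using V(1) by (simp add: sum_distrib_left flip: sum.inter_filter)
  qed simp
  finally show ?thesis .
qed

lemma sum_weighted_degree_edge:
  assumes "simple_graph V E"
  shows "(\<Sum>v\<in>V. weighted_degree E w v) = 2 * (\<Sum>e\<in>E. w e)"
proof -
  have "(\<Sum>v\<in>V. weighted_degree E w v) = (\<Sum>e\<in>E. w e * 2)"
    using sum_weighted_degree[OF assms, of "\<lambda>_. 1" w] assms by (simp add: simple_graph_def)
  then show ?thesis by (simp add: sum_distrib_right mult.commute)
qed

text \<open>A cover truncated at 1 is still a cover, since an end cut down to 1 covers its edges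
  alone. The upper bound 1 makes the factors \<open>1 - c v\<close> in the slackness terms
  nonnegative.\<close>

lemma near_optimal_vertex_cover:
  assumes G: "simple_graph V E" and "0 < \<epsilon>"
  obtains c where "\<And>v. v \<in> V \<Longrightarrow> 0 \<le> c v" "\<And>v. v \<in> V \<Longrightarrow> c v \<le> 1"
    "\<And>e. e \<in> E \<Longrightarrow> 1 \<le> (\<Sum>v\<in>e. c v)" "(\<Sum>v\<in>V. c v) < fractional_cover_number V E + \<epsilon>"
proof -
  let ?S = "{(\<Sum>v\<in>V. c v) | c. fractional_vertex_cover V E c}"
  have "fractional_vertex_cover V E (\<lambda>_. 1)" by (simp add: fractional_vertex_cover_def)
  then have "?S \<noteq> {}" by auto
  moreover have "Inf ?S < fractional_cover_number V E + \<epsilon>"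
    using assms(2) by (simp add: fractional_cover_number_def)
  ultimately obtain c where c: "fractional_vertex_cover V E c"
    "(\<Sum>v\<in>V. c v) < fractional_cover_number V E + \<epsilon>"
    using cInf_lessD[of ?S] by blast
  define d where "d v = min (c v) 1" for v
  have "(\<Sum>v\<in>V. d v) \<le> (\<Sum>v\<in>V. c v)" by (intro sum_mono) (simp add: d_def)
  moreover have "1 \<le> (\<Sum>v\<in>e. d v)" if e: "e \<in> E" for e
  proof -
    have "card e = 2" "e \<subseteq> V" using G e by (auto simp: simple_graph_def)
    then obtain u v where uv: "e = {u, v}" "u \<noteq> v" "u \<in> V" "v \<in> V" by (auto simp: card_2_iff)
    then have "1 \<le> c u + c v" "0 \<le> c u" "0 \<le> c v"
      using c(1) e by (auto simp: fractional_vertex_cover_def)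
    then show ?thesis using uv by (simp add: d_def)
  qed
  ultimately show ?thesis
    using c by (intro that[of d]) (auto simp: d_def fractional_vertex_cover_def)
qed

text \<open>Both weightings are optimal against every near-optimal vertex cover, so complementary
  slackness holds up to an arbitrarily small error; this avoids attaining the infimum in
  \<^const>\<open>fractional_cover_number\<close>.\<close>

lemma approximate_slackness:
  assumes G: "simple_graph V E" and w: "max_fractional_matching V E w"
    and w': "min_fractional_edge_cover V E w'" and "0 < \<epsilon>"
  obtains c where "\<And>u v. {u, v} \<in> E \<Longrightarrow> u \<noteq> v \<Longrightarrow> 1 \<le> c u + c v"
    "\<And>v. v \<in> V \<Longrightarrow> c v * (1 - weighted_degree E w v) < \<epsilon>"
    "\<And>v. v \<in> V \<Longrightarrow> (1 - c v) * (weighted_degree E w' v - 1) < \<epsilon>"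
    "\<And>u v. {u, v} \<in> E \<Longrightarrow> u \<noteq> v \<Longrightarrow> w' {u, v} * (c u + c v - 1) < \<epsilon>"
proof -
  obtain c where c: "\<And>v. v \<in> V \<Longrightarrow> 0 \<le> c v" "\<And>v. v \<in> V \<Longrightarrow> c v \<le> 1"
    "\<And>e. e \<in> E \<Longrightarrow> 1 \<le> (\<Sum>v\<in>e. c v)" "(\<Sum>v\<in>V. c v) < fractional_cover_number V E + \<epsilon>"
    using near_optimal_vertex_cover[OF G assms(4)] by metis
  have fin: "finite V" "finite E"
    using G simple_graph_finite_edges by (auto simp: simple_graph_def)
  let ?x = "\<lambda>v. c v * (1 - weighted_degree E w v)"
  let ?y = "\<lambda>v. (1 - c v) * (weighted_degree E w' v - 1)"
  let ?z = "\<lambda>w e. w e * ((\<Sum>v\<in>e. c v) - 1)"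
  have nn: "0 \<le> ?x v" "0 \<le> ?y v" if "v \<in> V" for v
    using that c w w'
    by (auto simp: max_fractional_matching_def fractional_matching_def
        min_fractional_edge_cover_def fractional_edge_cover_def)
  have nnz: "0 \<le> ?z w e" "0 \<le> ?z w' e" if "e \<in> E" for e
    using that c(3)[OF that] w w'
    by (auto simp: max_fractional_matching_def fractional_matching_def
        min_fractional_edge_cover_def fractional_edge_cover_def)
  \<comment> \<open>The gap between the cover and the matching is a sum of nonnegative slack terms,
    so a small gap makes each of them small.\<close>
  have "(\<Sum>v\<in>V. ?x v) + (\<Sum>e\<in>E. ?z w e) = (\<Sum>v\<in>V. c v) - (\<Sum>e\<in>E. w e)"
    using sum_weighted_degree[OF G, of c w] by (simp add: right_diff_distrib sum_subtractf)
  also have "\<dots> < \<epsilon>" using c(4) w by (simp add: max_fractional_matching_def)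
  finally have 1: "(\<Sum>v\<in>V. ?x v) + (\<Sum>e\<in>E. ?z w e) < \<epsilon>" .
  \<comment> \<open>For the edge cover the plain degree sum enters too; it is twice the total
    weight, and half of it cancels against the edge terms.\<close>
  have "(\<Sum>v\<in>V. ?y v) + (\<Sum>e\<in>E. ?z w' e) = (\<Sum>v\<in>V. c v) + (\<Sum>e\<in>E. w' e) - card V"
    using sum_weighted_degree[OF G, of c w'] sum_weighted_degree_edge[OF G, of w']
    by (simp add: algebra_simps sum_subtractf sum.distrib)
  also have "\<dots> < \<epsilon>" using c(4) w' by (simp add: min_fractional_edge_cover_def)
  finally have 2: "(\<Sum>v\<in>V. ?y v) + (\<Sum>e\<in>E. ?z w' e) < \<epsilon>" .
  show ?thesis
  proof (rule that[of c])
    show "1 \<le> c u + c v" if "{u, v} \<in> E" "u \<noteq> v" for u v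
      using c(3)[OF that(1)] that(2) by simp
    show "?x v < \<epsilon>" if "v \<in> V" for v
      using member_le_sum[OF that, of ?x] nn fin sum_nonneg[of E "?z w"] nnz 1 by force
    show "?y v < \<epsilon>" if "v \<in> V" for v
      using member_le_sum[OF that, of ?y] nn fin sum_nonneg[of E "?z w'"] nnz 2 by force
    show "w' {u, v} * (c u + c v - 1) < \<epsilon>" if "{u, v} \<in> E" "u \<noteq> v" for u v
      using member_le_sum[OF that(1), of "?z w'"] fin sum_nonneg[of V ?y] nn nnz 2 that(2) by force
  qed
qed

text \<open>Slackness in \<open>w\<close> pushes \<open>c v\<close> towards 0 at such a vertex; a
  \<open>w'\<close>-degree above 1 would push it towards 1 as well.\<close>

lemma unsaturated_cover_degree:
  assumes G: "simple_graph V E" and w: "max_fractional_matching V E w"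
    and w': "min_fractional_edge_cover V E w'" and v: "v \<in> V" "weighted_degree E w v < 1"
  shows "weighted_degree E w' v = 1"
proof (rule ccontr)
  assume "weighted_degree E w' v \<noteq> 1"
  then have gt: "1 < weighted_degree E w' v"
    using w' v by (force simp: min_fractional_edge_cover_def fractional_edge_cover_def)
  \<comment> \<open>Half of the smaller gap yields \<open>c v < 1 / 2\<close> and
    \<open>1 - c v < 1 / 2\<close>, which are incompatible.\<close>
  define \<epsilon> where "\<epsilon> = min (1 - weighted_degree E w v) (weighted_degree E w' v - 1) / 2"
  have "0 < \<epsilon>" using gt v by (simp add: \<epsilon>_def)
  then obtain c where c: "\<And>v. v \<in> V \<Longrightarrow> c v * (1 - weighted_degree E w v) < \<epsilon>"
    "\<And>v. v \<in> V \<Longrightarrow> (1 - c v) * (weighted_degree E w' v - 1) < \<epsilon>"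
    by (rule approximate_slackness[OF G w w']) blast
  note c[OF v(1)]
  moreover have "\<epsilon> \<le> (1 / 2) * (1 - weighted_degree E w v)" "\<epsilon> \<le> (1 / 2) * (weighted_degree E w' v - 1)"
    by (auto simp: \<epsilon>_def)
  ultimately have "c v * (1 - weighted_degree E w v) < (1 / 2) * (1 - weighted_degree E w v)"
    "(1 - c v) * (weighted_degree E w' v - 1) < (1 / 2) * (weighted_degree E w' v - 1)" by linarith+
  then have "c v < 1 / 2" "1 - c v < 1 / 2"
    using gt v(2) by (auto simp only: mult_less_cancel_right)
  then show False by simp
qed

text \<open>If both ends were unsaturated, slackness would make \<open>c u\<close> and
  \<open>c v\<close> both less than 1/2, and the edge would not be covered.\<close>

lemma unsaturated_independent:
  assumes G: "simple_graph V E" and w: "max_fractional_matching V E w"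
    and w': "min_fractional_edge_cover V E w'" and e: "{u, v} \<in> E" "u \<noteq> v"
    and lt: "weighted_degree E w u < 1"
  shows "1 \<le> weighted_degree E w v"
proof (rule ccontr)
  assume "\<not> 1 \<le> weighted_degree E w v"
  then have lt': "weighted_degree E w v < 1" by simp
  have V: "u \<in> V" "v \<in> V" using G e by (auto simp: simple_graph_def)
  define \<epsilon> where "\<epsilon> = min (1 - weighted_degree E w u) (1 - weighted_degree E w v) / 2"
  have "0 < \<epsilon>" using lt lt' by (simp add: \<epsilon>_def)
  then obtain c where c: "1 \<le> c u + c v"
    "c u * (1 - weighted_degree E w u) < \<epsilon>" "c v * (1 - weighted_degree E w v) < \<epsilon>"
    by (rule approximate_slackness[OF G w w']) (use V e in blast)
  moreover have "\<epsilon> \<le> (1 / 2) * (1 - weighted_degree E w u)" "\<epsilon> \<le> (1 / 2) * (1 - weighted_degree E w v)"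
    by (auto simp: \<epsilon>_def)
  ultimately have "c u * (1 - weighted_degree E w u) < (1 / 2) * (1 - weighted_degree E w u)"
    "c v * (1 - weighted_degree E w v) < (1 / 2) * (1 - weighted_degree E w v)" by linarith+
  then have "c u < 1 / 2" "c v < 1 / 2"
    using lt lt' by (auto simp only: mult_less_cancel_right)
  then show False using c(1) by simp
qed

text \<open>Two ends of \<open>w'\<close>-degree above 1 would have \<open>c\<close> close to 1,
  whereas a positive \<open>w'\<close> on the edge keeps \<open>c u + c v\<close> close to
  1.\<close>

lemma overcovered_independent:
  assumes G: "simple_graph V E" and w: "max_fractional_matching V E w"
    and w': "min_fractional_edge_cover V E w'" and e: "{u, v} \<in> E" "u \<noteq> v" "0 < w' {u, v}"
    and gt: "1 < weighted_degree E w' u"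
  shows "weighted_degree E w' v \<le> 1"
proof (rule ccontr)
  assume "\<not> weighted_degree E w' v \<le> 1"
  then have gt': "1 < weighted_degree E w' v" by simp
  have V: "u \<in> V" "v \<in> V" using G e by (auto simp: simple_graph_def)
  \<comment> \<open>A third of the smallest gap puts both values above 2/3 and their sum below
    4/3.\<close>
  define \<epsilon> where
    "\<epsilon> = min (w' {u, v}) (min (weighted_degree E w' u - 1) (weighted_degree E w' v - 1)) / 3"
  have "0 < \<epsilon>" using gt gt' e by (simp add: \<epsilon>_def)
  then obtain c where "(1 - c u) * (weighted_degree E w' u - 1) < \<epsilon>"
    "(1 - c v) * (weighted_degree E w' v - 1) < \<epsilon>" "w' {u, v} * (c u + c v - 1) < \<epsilon>"
    by (rule approximate_slackness[OF G w w']) (use V e in blast)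
  moreover have "\<epsilon> \<le> (1 / 3) * (weighted_degree E w' u - 1)"
    "\<epsilon> \<le> (1 / 3) * (weighted_degree E w' v - 1)" "\<epsilon> \<le> w' {u, v} * (1 / 3)"
    by (auto simp: \<epsilon>_def)
  ultimately have "(1 - c u) * (weighted_degree E w' u - 1) < (1 / 3) * (weighted_degree E w' u - 1)"
    "(1 - c v) * (weighted_degree E w' v - 1) < (1 / 3) * (weighted_degree E w' v - 1)"
    "w' {u, v} * (c u + c v - 1) < w' {u, v} * (1 / 3)" by linarith+
  then have "1 - c u < 1 / 3" "1 - c v < 1 / 3" "c u + c v - 1 < 1 / 3"
    using gt gt' e(3) by (auto simp only: mult_less_cancel_right mult_less_cancel_left)
  then show False by simp
qed

text \<open>Passing from \<open>w\<close> to \<open>w'\<close> strictly raises the degree at both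
  ends. If \<open>x\<close> is unsaturated, then \<open>y\<close> is saturated and hence
  overcovered. If \<open>x\<close> is saturated, it is overcovered, so \<open>y\<close> has
  \<open>w'\<close>-degree at most 1 and is unsaturated.\<close>

lemma raised_edge_ends:
  assumes G: "simple_graph V E" and w: "max_fractional_matching V E w"
    and w': "min_fractional_edge_cover V E w'" and le: "\<And>e. e \<in> E \<Longrightarrow> w e \<le> w' e"
    and e: "e \<in> E" "w e < w' e"
  obtains u t where "e = {u, t}" "u \<noteq> t" "1 < weighted_degree E w' u" "1 \<le> weighted_degree E w u"
    "weighted_degree E w' t = 1" "weighted_degree E w t < 1"
proof -
  have "card e = 2" and eV: "e \<subseteq> V" using G e by (auto simp: simple_graph_def)
  then obtain x y where xy: "e = {x, y}" "x \<noteq> y" by (auto simp: card_2_iff)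
  have V: "x \<in> V" "y \<in> V" using eV xy by auto
  have "0 \<le> w e" using w e by (simp add: max_fractional_matching_def fractional_matching_def)
  then have pos: "0 < w' {x, y}" using e xy by simp
  have lt: "weighted_degree E w v < weighted_degree E w' v" if "v \<in> e" for v
    using e le that simple_graph_finite_edges[OF G] by (intro sum_strict_mono_ex1) auto
  have yx: "{y, x} \<in> E" "{x, y} \<in> E" "y \<noteq> x" using e xy by (auto simp: insert_commute)
  have deg: "weighted_degree E w x < weighted_degree E w' x" "weighted_degree E w y < weighted_degree E w' y"
    using lt xy by auto
  show ?thesis
  proof (cases "weighted_degree E w x < 1")
    case True
    have y: "1 \<le> weighted_degree E w y"
      by (rule unsaturated_independent[OF G w w' yx(2) xy(2) True])
    show ?thesis
    proof (rule that)
      show "e = {y, x}" using xy by auto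
      show "1 < weighted_degree E w' y" using y deg(2) by linarith
      show "weighted_degree E w' x = 1" by (rule unsaturated_cover_degree[OF G w w' V(1) True])
    qed (fact yx(3) y True)+
  next
    case False
    then have x: "1 < weighted_degree E w' x" "1 \<le> weighted_degree E w x" using deg(1) by linarith+
    have "weighted_degree E w' y \<le> 1"
      by (rule overcovered_independent[OF G w w' yx(2) xy(2) pos x(1)])
    then have y: "weighted_degree E w y < 1" using deg(2) by linarith
    show ?thesis
    proof (rule that)
      show "weighted_degree E w' y = 1" by (rule unsaturated_cover_degree[OF G w w' V(2) y])
    qed (fact xy x y)+
  qed
qed

section \<open>Norms of measurable functions on edges\<close>

lemma complete_measure_lebesgue_on:
  assumes "S \<in> sets lebesgue"
  shows "complete_measure (lebesgue_on S)"
proof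
  fix A N :: "'a set"
  assume "A \<subseteq> N" "N \<in> null_sets (lebesgue_on S)"
  then have "A \<subseteq> S" "A \<in> null_sets lebesgue"
    using assms by (auto simp: null_sets_restrict_space intro: null_sets_completion_subset)
  then show "A \<in> sets (lebesgue_on S)"
    using assms by (auto simp: sets_restrict_space_iff)
qed

text \<open>Preimages under \<open>f\<close> and \<open>g\<close> differ by a null set, which
  completeness makes measurable. The range condition takes care of the points where the functions
  differ.\<close>

lemma (in complete_measure) measurable_AE_eq:
  assumes "g \<in> measurable M N" "AE x in M. f x = g x" "f \<in> space M \<rightarrow> space N"
  shows "f \<in> measurable M N"
proof (rule measurableI)
  fix A assume A: "A \<in> sets N"
  show "f -` A \<inter> space M \<in> sets M"
  proof (rule in_sets_AE)
    show "g -` A \<inter> space M \<in> sets M" using assms(1) A by (rule measurable_sets)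
    show "AE x in M. x \<in> g -` A \<inter> space M \<longleftrightarrow> x \<in> f -` A \<inter> space M"
      using assms(2) by eventually_elim auto
  qed auto
qed (use assms(3) in auto)

text \<open>The inequalities above concern the uncompleted product, so the absolute value of an edge
  function is replaced there by a bounded measurable function.\<close>

lemma completion_abs_representative:
  fixes f :: "'b \<Rightarrow> real"
  assumes "f \<in> borel_measurable (completion N)" "\<And>x. x \<in> space N \<Longrightarrow> \<bar>f x\<bar> \<le> K"
  obtains g where "bounded_nonneg N g" "AE x in N. \<bar>f x\<bar> = g x"
proof -
  obtain f' where [measurable]: "f' \<in> borel_measurable N" and ae: "AE x in N. f x = f' x"
    using completion_ex_borel_measurable_real[OF assms(1)] by auto
  \<comment> \<open>The minimum with \<open>K\<close> restores a bound at every point, since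
    \<open>f'\<close> may be unbounded on the null set where it differs from
    \<open>f\<close>.\<close>
  have "0 \<le> min K \<bar>f' x\<bar>" if "x \<in> space N" for x
    using assms(2)[OF that] by simp
  then have "bounded_nonneg N (\<lambda>x. min K \<bar>f' x\<bar>)"
    unfolding bounded_nonneg_def by (intro conjI exI[of _ K]) auto
  moreover have "AE x in N. \<bar>f x\<bar> = min K \<bar>f' x\<bar>"
    using ae
  proof (rule AE_mp, intro AE_I2 impI)
    fix x assume "x \<in> space N" "f x = f' x"
    then show "\<bar>f x\<bar> = min K \<bar>f' x\<bar>" using assms(2)[of x] by simp
  qed
  ultimately show ?thesis by (rule that)
qed

text \<open>The bound \<open>K\<close> keeps the extended essential supremum finite, so
  \<open>enn2real\<close> does not turn it into 0.\<close>

lemma AE_le_ess_sup_abs: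
  assumes "f \<in> borel_measurable N" "AE x in N. \<bar>f x\<bar> \<le> K"
  shows "AE x in N. \<bar>f x\<bar> \<le> ess_sup_abs N f"
proof -
  have "esssup N (\<lambda>x. ennreal \<bar>f x\<bar>) \<le> ennreal K"
    using assms by (intro esssup_I) (auto elim: eventually_mono intro: ennreal_leI)
  then have fin: "esssup N (\<lambda>x. ennreal \<bar>f x\<bar>) < top"
    using ennreal_less_top by (rule le_less_trans)
  show ?thesis
    using esssup_AE[of "\<lambda>x. ennreal \<bar>f x\<bar>" N]
  proof eventually_elim
    case (elim x)
    then have "enn2real (ennreal \<bar>f x\<bar>) \<le> enn2real (esssup N (\<lambda>x. ennreal \<bar>f x\<bar>))"
      using fin by (intro enn2real_mono) auto
    then show ?case by (simp add: ess_sup_abs_def)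
  qed
qed

lemma ess_sup_abs_nonneg: "0 \<le> ess_sup_abs N f"
  by (simp add: ess_sup_abs_def)

lemma L_norm_inverse:
  assumes "0 < a"
  shows "L_norm N (1 / ennreal a) f = (\<integral>x. \<bar>f x\<bar> powr (1 / a) \<partial>N) powr a"
proof -
  have "1 / ennreal a = ennreal (1 / a)"
    using assms divide_ennreal[of 1 a] by simp
  then show ?thesis using assms by (simp add: L_norm_def)
qed

lemma L_norm_completion_representative:
  assumes "f \<in> borel_measurable (completion N)" "bounded_nonneg N g" "AE x in N. \<bar>f x\<bar> = g x" "0 < a"
  shows "L_norm (completion N) (1 / ennreal a) f = (\<integral>x. g x powr (1 / a) \<partial>N) powr a"
proof -
  have [measurable]: "f \<in> borel_measurable (completion N)" by fact
  have m: "(\<lambda>x. g x powr (1 / a)) \<in> borel_measurable N"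
    using assms(2,4) by (intro bounded_nonneg_measurable bounded_nonneg_powr) auto
  have "(\<integral>x. \<bar>f x\<bar> powr (1 / a) \<partial>completion N) = (\<integral>x. g x powr (1 / a) \<partial>completion N)"
    using AE_completion[OF assms(3)] measurable_completion[OF m]
    by (intro integral_cong_AE) (auto elim: eventually_mono)
  also have "\<dots> = (\<integral>x. g x powr (1 / a) \<partial>N)"
    using m by (rule integral_completion)
  finally show ?thesis using assms(4) by (simp add: L_norm_inverse)
qed

lemma edge_point_merge: "merge {u} {t} (y, z) = edge_point {u, t} u (y u) (z t)"
  by (auto simp: merge_def edge_point_def fun_eq_iff)

text \<open>Complete factors make almost every section of an edge function measurable, although the
  function itself is measurable only for the completed product.\<close>

locale product_complete_measure = product_finite_measure M for M :: "'i \<Rightarrow> real measure" +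
  assumes complete_measures: "complete_measure (M i)"
begin

lemma measurable_edge_point:
  assumes "u \<noteq> t"
  shows "(\<lambda>x. edge_point {u, t} u (fst x) (snd x)) \<in> M u \<Otimes>\<^sub>M M t \<rightarrow>\<^sub>M PiM {u, t} M"
  unfolding edge_point_def
proof (rule measurable_restrict)
  fix i assume "i \<in> {u, t}"
  then show "(\<lambda>x. if i = u then fst x else snd x) \<in> M u \<Otimes>\<^sub>M M t \<rightarrow>\<^sub>M M i"
    using assms by auto
qed

text \<open>Moves almost-everywhere statements from the product indexed by the edge to a product of
  pairs, where they descend to almost every section.\<close>

lemma distr_edge_point:
  assumes "u \<noteq> t"
  shows "distr (M u \<Otimes>\<^sub>M M t) (PiM {u, t} M) (\<lambda>x. edge_point {u, t} u (fst x) (snd x)) = PiM {u, t} M"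
proof (rule PiM_eqI)
  interpret ut: pair_sigma_finite "M u" "M t"
    by (intro pair_sigma_finite.intro sigma_finite_measures)
  fix A assume A: "\<And>i. i \<in> {u, t} \<Longrightarrow> A i \<in> sets (M i)"
  have "(\<lambda>x. edge_point {u, t} u (fst x) (snd x)) -` (PiE {u, t} A) \<inter> space (M u \<Otimes>\<^sub>M M t)
      = A u \<times> A t"
    using A[THEN sets.sets_into_space] assms
    by (fastforce simp: edge_point_def space_pair_measure PiE_iff extensional_def split: if_splits)
  then show "emeasure (distr (M u \<Otimes>\<^sub>M M t) (PiM {u, t} M)
      (\<lambda>x. edge_point {u, t} u (fst x) (snd x))) (PiE {u, t} A) = (\<Prod>i\<in>{u, t}. emeasure (M i) (A i))"
    using A assms measurable_edge_point[OF assms]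
    by (subst emeasure_distr) (auto simp: sigma_finite_measure.emeasure_pair_measure_Times[OF sigma_finite_measures] intro!: sets_PiM_I_finite)
qed auto

text \<open>\<open>S\<close> is formed from the original function, \<open>G\<close> from its
  representative. For almost every \<open>s\<close> the sections agree almost everywhere, so
  \<open>S s = G s powr a\<close>; as \<open>G\<close> is bounded, the essential supremum of
  \<open>S\<close> is finite and dominates.\<close>

lemma section_integral_le_ess_sup:
  assumes ut: "u \<noteq> t" and g: "bounded_nonneg (PiM {u, t} M) g"
    and fg: "AE x in PiM {u, t} M. \<bar>f x\<bar> = g x" and "0 < a"
  defines "S \<equiv> (\<lambda>s. L_norm (M t) (1 / ennreal a) (\<lambda>r. f (edge_point {u, t} u s r)))"
  shows "AE y in PiM {u} M. (\<integral>z. g (merge {u} {t} (y, z)) powr (1 / a) \<partial>PiM {t} M)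
    \<le> ess_sup_abs (M u) S powr (1 / a)"
proof -
  interpret ut: pair_sigma_finite "M u" "M t"
    by (intro pair_sigma_finite.intro sigma_finite_measures)
  interpret u: complete_measure "M u" by (rule complete_measures)
  interpret t: complete_measure "M t" by (rule complete_measures)
  define G where "G s = (\<integral>r. g (edge_point {u, t} u s r) powr (1 / a) \<partial>M t)" for s
  have bg: "bounded_nonneg (M u \<Otimes>\<^sub>M M t) (\<lambda>x. g (edge_point {u, t} u (fst x) (snd x)) powr (1 / a))"
    using \<open>0 < a\<close>
    by (intro bounded_nonneg_powr bounded_nonneg_compose[OF g measurable_edge_point] ut) auto
  have bG: "bounded_nonneg (M u) G"
    unfolding G_def using bg by (intro bounded_nonneg_integral finite_measures) simp
  have sec: "(\<lambda>r. g (edge_point {u, t} u s r)) \<in> borel_measurable (M t)" if "s \<in> space (M u)" for s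
    using measurable_compose[OF measurable_compose[OF measurable_Pair1'[OF that] measurable_edge_point[OF ut]]
        bounded_nonneg_measurable[OF g]] by simp
  have "AE x in distr (M u \<Otimes>\<^sub>M M t) (PiM {u, t} M)
      (\<lambda>x. edge_point {u, t} u (fst x) (snd x)). \<bar>f x\<bar> = g x"
    using fg by (simp only: distr_edge_point[OF ut])
  then have "AE x in M u \<Otimes>\<^sub>M M t. \<bar>f (edge_point {u, t} u (fst x) (snd x))\<bar> = g (edge_point {u, t} u (fst x) (snd x))"
    by (rule AE_distrD[OF measurable_edge_point[OF ut]])
  then have "AE s in M u. AE r in M t. \<bar>f (edge_point {u, t} u s r)\<bar> = g (edge_point {u, t} u s r)"
    by (rule ut.AE_pair[where Q = "\<lambda>x. \<bar>f (edge_point {u, t} u (fst x) (snd x))\<bar>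
      = g (edge_point {u, t} u (fst x) (snd x))", simplified])
  then have SG: "AE s in M u. S s = G s powr a"
  proof (rule AE_mp, intro AE_I2 impI)
    fix s assume s: "s \<in> space (M u)"
      and ae: "AE r in M t. \<bar>f (edge_point {u, t} u s r)\<bar> = g (edge_point {u, t} u s r)"
    have [measurable]: "(\<lambda>r. \<bar>f (edge_point {u, t} u s r)\<bar>) \<in> borel_measurable (M t)"
      by (rule t.measurable_AE_eq[OF sec[OF s] ae]) auto
    note sec[OF s, measurable]
    have "(\<integral>r. \<bar>f (edge_point {u, t} u s r)\<bar> powr (1 / a) \<partial>M t) = G s"
      unfolding G_def using ae by (intro integral_cong_AE) (auto elim: eventually_mono)
    then show "S s = G s powr a" using \<open>0 < a\<close> by (simp add: S_def L_norm_inverse)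
  qed
  have bGa: "bounded_nonneg (M u) (\<lambda>s. G s powr a)"
    using bG \<open>0 < a\<close> by (intro bounded_nonneg_powr) auto
  then obtain K where K: "\<And>s. s \<in> space (M u) \<Longrightarrow> G s powr a \<le> K"
    by (auto simp: bounded_nonneg_def)
  \<comment> \<open>Completeness of \<open>M u\<close> transfers measurability from \<open>G\<close>
    to \<open>S\<close>, just as completeness of \<open>M t\<close> did for the sections.\<close>
  have "S \<in> borel_measurable (M u)"
    by (rule u.measurable_AE_eq[OF bounded_nonneg_measurable[OF bGa] SG]) auto
  moreover have "AE s in M u. \<bar>S s\<bar> \<le> K"
    using SG by (rule AE_mp) (use K in \<open>auto intro!: AE_I2\<close>)
  ultimately have "AE s in M u. \<bar>S s\<bar> \<le> ess_sup_abs (M u) S"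
    by (rule AE_le_ess_sup_abs)
  with SG have "AE s in M u. G s powr a \<le> ess_sup_abs (M u) S"
    by eventually_elim auto
  then have "AE s in M u. G s \<le> ess_sup_abs (M u) S powr (1 / a)"
  proof (rule AE_mp, intro AE_I2 impI)
    fix s assume "s \<in> space (M u)" "G s powr a \<le> ess_sup_abs (M u) S"
    then have "(G s powr a) powr (1 / a) \<le> ess_sup_abs (M u) S powr (1 / a)"
      using \<open>0 < a\<close> by (intro powr_mono2) auto
    then show "G s \<le> ess_sup_abs (M u) S powr (1 / a)"
      using \<open>0 < a\<close> bounded_nonneg_nonneg[OF bG \<open>s \<in> space (M u)\<close>] by (simp add: powr_powr)
  qed
  then have "AE s in distr (PiM {u} M) (M u) (\<lambda>y. y u). G s \<le> ess_sup_abs (M u) S powr (1 / a)"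
    by (simp only: distr_singleton)
  then have "AE y in PiM {u} M. G (y u) \<le> ess_sup_abs (M u) S powr (1 / a)"
    by (rule AE_distrD[rotated]) simp
  then show ?thesis
  proof (rule AE_mp, intro AE_I2 impI)
    fix y assume y: "y \<in> space (PiM {u} M)" and le: "G (y u) \<le> ess_sup_abs (M u) S powr (1 / a)"
    have "y u \<in> space (M u)" using y by (auto simp: space_PiM)
    note sec[OF this, measurable]
    have "(\<integral>z. g (merge {u} {t} (y, z)) powr (1 / a) \<partial>PiM {t} M) = G (y u)"
      unfolding edge_point_merge G_def
      by (rule product_integral_singleton) measurable
    then show "(\<integral>z. g (merge {u} {t} (y, z)) powr (1 / a) \<partial>PiM {t} M)
        \<le> ess_sup_abs (M u) S powr (1 / a)" using le by simp
  qed
qed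

end

section \<open>The integral inequality\<close>

text \<open>After the products are swapped, an edge of \<open>R\<close> contributes one factor, as
  it meets \<open>S\<close> in \<open>u e\<close> only, and any other edge contributes 1. It serves
  with \<open>S'\<close> for \<open>S\<close>.\<close>

lemma prod_incident_single:
  fixes \<phi> :: "'a set \<Rightarrow> 'a \<Rightarrow> real"
  assumes "finite S" "finite E" "R \<subseteq> E"
    and "\<And>e. e \<in> R \<Longrightarrow> {v \<in> S. v \<in> e} = {u e}"
    and "\<And>e v. e \<in> E - R \<Longrightarrow> \<phi> e v = 1"
  shows "(\<Prod>v\<in>S. \<Prod>e | e \<in> E \<and> v \<in> e. \<phi> e v) = (\<Prod>e\<in>R. \<phi> e (u e))"
proof -
  have "(\<Prod>v\<in>S. \<Prod>e | e \<in> E \<and> v \<in> e. \<phi> e v) = (\<Prod>e\<in>E. \<Prod>v | v \<in> S \<and> v \<in> e. \<phi> e v)"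
    using assms(1,2) by (rule prod.swap_restrict)
  also have "\<dots> = (\<Prod>e\<in>R. \<Prod>v | v \<in> S \<and> v \<in> e. \<phi> e v)"
    using assms(2,3,5) by (intro prod.mono_neutral_right) auto
  also have "\<dots> = (\<Prod>e\<in>R. \<phi> e (u e))"
    using assms(4) by (intro prod.cong) auto
  finally show ?thesis .
qed

lemma rpow_excess_ratio:
  assumes "w < w'" "0 \<le> w" "0 \<le> x"
  shows "rpow x (excess_ratio w w') = (x powr (1 / w')) powr (w' - w)"
  using assms by (simp add: rpow_def excess_ratio_def powr_powr)

text \<open>For \<open>w = 0\<close> the value is 1 even when \<open>x\<close> is 0, where
  \<open>powr\<close> would give 0; hence the case distinction.\<close>

lemma rpow_matching_ratio:
  assumes "0 < w'" "0 \<le> w"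
  shows "rpow (x powr w') (matching_ratio w w') = (if 0 < w then x powr w else 1)"
  using assms by (simp add: rpow_def matching_ratio_def powr_powr)

theorem theorem6p2:
  fixes V :: "'a set" and E :: "'a set set"
    and B :: "'a \<Rightarrow> real set"
    and f :: "'a set \<Rightarrow> ('a \<Rightarrow> real) \<Rightarrow> real"
    and w w' :: "'a set \<Rightarrow> real"
    and S' :: "'a set"
  assumes "simple_graph V E"
    and "no_isolated_vertices V E"
    and "\<And>v. v \<in> V \<Longrightarrow> B v \<in> sets lebesgue \<and> B v \<subseteq> {0..1}"
    and "\<And>e. e \<in> E \<Longrightarrow> f e \<in> borel_measurable (box_measure B e)"
    and "\<And>e. e \<in> E \<Longrightarrow> \<exists>K. \<forall>x\<in>(\<Pi>\<^sub>E v\<in>e. B v). \<bar>f e x\<bar> \<le> K"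
    and "max_fractional_matching V E w"
    and "min_fractional_edge_cover V E w'"
    and "\<And>e. e \<in> E \<Longrightarrow> w e \<le> w' e"
    and "S' = {v \<in> V. 1 < (\<Sum>e | e \<in> E \<and> v \<in> e. w' e)}"
  shows "(\<integral>x. (\<Prod>e\<in>E. f e (restrict x e)) \<partial>box_measure B V)
    \<le> (\<Prod>v\<in>S'. \<Prod>e | e \<in> E \<and> v \<in> e.
          rpow (mixed_norm B e v (1 / ennreal (w' e)) (f e)) (excess_ratio (w e) (w' e)))
      * (\<Prod>e\<in>E. rpow (edge_norm B e (1 / ennreal (w' e)) (f e)) (matching_ratio (w e) (w' e)))"
proof -
  note G = assms(1) and max = assms(6) and min = assms(7) and le = assms(8)
  have finV: "finite V" and finE: "finite E" and EV: "\<And>e. e \<in> E \<Longrightarrow> e \<subseteq> V"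
    using G simple_graph_finite_edges by (auto simp: simple_graph_def)
  have w0: "0 \<le> w e" if "e \<in> E" for e
    using max that by (simp add: max_fractional_matching_def fractional_matching_def)
  have deg_w: "weighted_degree E w v \<le> 1" if "v \<in> V" for v
    using max that by (simp add: max_fractional_matching_def fractional_matching_def)

  \<comment> \<open>\<open>B\<close> is arbitrary outside \<open>V\<close>; the empty set there
    makes the measure finite and complete at every index, as the locale asks.\<close>
  define M where "M v = lebesgue_on (if v \<in> V then B v else {})" for v
  have meas: "(if v \<in> V then B v else {}) \<in> lmeasurable" for v
    using assms(3)[of v] lmeasurable_cbox[of 0 "1::real"]
    by (auto intro: fmeasurableI2[of "{0..1}"])
  have finite_M: "finite_measure (M v)" for v
    unfolding M_def by (rule finite_measure_lebesgue_on[OF meas])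
  have complete_M: "complete_measure (M v)" for v
    unfolding M_def using meas[of v] by (intro complete_measure_lebesgue_on fmeasurableD)
  interpret product_complete_measure M
    using finite_M complete_M
    by (intro product_complete_measure.intro product_complete_measure_axioms.intro
        product_finite_measure.intro product_finite_measure_axioms.intro
        product_sigma_finite.intro finite_measure.axioms(1))
  have box: "box_measure B A = completion (PiM A M)" if "A \<subseteq> V" for A
    unfolding box_measure_def M_def using that
    by (intro arg_cong[where f = completion] PiM_cong) auto
  have MB: "lebesgue_on (B v) = M v" if "v \<in> V" for v
    using that by (simp add: M_def)
  have f_meas: "f e \<in> borel_measurable (completion (PiM e M))" if "e \<in> E" for e
    using assms(4)[OF that] box[OF EV[OF that]] by simp
  have "\<exists>K. \<forall>x\<in>space (PiM e M). \<bar>f e x\<bar> \<le> K" if "e \<in> E" for e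
  proof -
    have "space (PiM e M) = (\<Pi>\<^sub>E v\<in>e. B v)"
      unfolding space_PiM M_def using EV[OF that] by (intro PiE_cong) auto
    then show ?thesis using assms(5)[OF that] by simp
  qed
  then obtain K where K: "\<And>e x. e \<in> E \<Longrightarrow> x \<in> space (PiM e M) \<Longrightarrow> \<bar>f e x\<bar> \<le> K e"
    by metis
  have "\<exists>g. bounded_nonneg (PiM e M) g \<and> (AE x in PiM e M. \<bar>f e x\<bar> = g x)" if "e \<in> E" for e
    using completion_abs_representative[OF f_meas[OF that] K[OF that]] by metis
  then obtain g where g: "\<And>e. e \<in> E \<Longrightarrow> bounded_nonneg (PiM e M) (g e)"
    "\<And>e. e \<in> E \<Longrightarrow> AE x in PiM e M. \<bar>f e x\<bar> = g e x"
    by metis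

  \<comment> \<open>Classification of the edges by weight, and the two ends of a raised edge\<close>
  define P where "P = {e \<in> E. 0 < w' e}"
  define R where "R = {e \<in> E. w e < w' e}"
  define T where "T = {v \<in> V. weighted_degree E w v < 1}"
  define h where "h e x = g e x powr (1 / w' e)" for e x
  have PE: "P \<subseteq> E" "finite P" using finE by (auto simp: P_def)
  \<comment> \<open>These edges have no exponent \<open>1 / w' e\<close>; their factors are bounded
    by the essential suprema collected in \<open>D\<close>.\<close>
  have not_P: "w' e = 0" "w e = 0" if "e \<in> E - P" for e
    using that w0[of e] le[of e] by (auto simp: P_def)
  have w'_pos: "0 < w' e" if "e \<in> P" for e using that by (simp add: P_def)
  have R_P: "R = {e \<in> P. w e < w' e}"
    using w0 by (fastforce simp: R_def P_def)
  have RE: "R \<subseteq> E" by (auto simp: R_def)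

  \<comment> \<open>A single predicate for both ends makes \<open>u\<close> and \<open>t\<close>
    come from the same orientation of the edge.\<close>
  define Q where "Q e u t \<longleftrightarrow> e = {u, t} \<and> u \<noteq> t \<and> u \<in> S' \<and> u \<notin> T \<and> t \<in> T \<and> t \<notin> S'" for e u t
  have "\<exists>u t. Q e u t" if "e \<in> R" for e
  proof -
    have "e \<in> E" "w e < w' e" using that by (auto simp: R_def)
    from raised_edge_ends[OF G max min le this] obtain u t where ut: "e = {u, t}" "u \<noteq> t"
      "1 < weighted_degree E w' u" "1 \<le> weighted_degree E w u"
      "weighted_degree E w' t = 1" "weighted_degree E w t < 1" .
    moreover have "u \<in> V" "t \<in> V" using EV[OF \<open>e \<in> E\<close>] ut(1) by auto
    ultimately show ?thesis
      unfolding Q_def assms(9) T_def by (intro exI[of _ u] exI[of _ t]) auto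
  qed
  then obtain u t where "\<And>e. e \<in> R \<Longrightarrow> Q e (u e) (t e)" by metis
  then have ut: "\<And>e. e \<in> R \<Longrightarrow> e = {u e, t e}" "\<And>e. e \<in> R \<Longrightarrow> u e \<noteq> t e"
    "\<And>e. e \<in> R \<Longrightarrow> u e \<in> S'" "\<And>e. e \<in> R \<Longrightarrow> u e \<notin> T"
    "\<And>e. e \<in> R \<Longrightarrow> t e \<in> T" "\<And>e. e \<in> R \<Longrightarrow> t e \<notin> S'"
    unfolding Q_def by auto
  define m where "m e = mixed_norm B e (u e) (1 / ennreal (w' e)) (f e)" for e
  define C where "C e = m e powr (1 / w' e)" for e
  define I where "I e = (\<integral>x. h e x \<partial>PiM e M)" for e
  define D where "D = (\<Prod>e\<in>E - P. ess_sup_abs (completion (PiM e M)) (f e))"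

  \<comment> \<open>The two-stage inequality for the representatives\<close>
  have bh: "bounded_nonneg (PiM e M) (h e)" if "e \<in> P" for e
    unfolding h_def using g(1) PE that w'_pos[OF that] by (intro bounded_nonneg_powr) auto
  have two_stage: "(\<integral>x. (\<Prod>e\<in>P. h e (restrict x e) powr w' e) \<partial>PiM V M)
    \<le> (\<Prod>e | e \<in> P \<and> w e < w' e. C e powr (w' e - w e)) * (\<Prod>e | e \<in> P \<and> 0 < w e. I e powr w e)"
    unfolding I_def
  proof (rule two_stage_Finner_inequality[where T = T])
    fix v assume v: "v \<in> T"
    have "(\<Sum>e | e \<in> P \<and> v \<in> e. w' e) = weighted_degree E w' v"
      using finE PE not_P by (intro sum.mono_neutral_left) auto
    then show "(\<Sum>e | e \<in> P \<and> v \<in> e. w' e) = 1"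
      using unsaturated_cover_degree[OF G max min, of v] v by (simp add: T_def)
  next
    fix v assume v: "v \<in> V - T"
    have "(\<Sum>e | e \<in> P \<and> v \<in> e. w e) = weighted_degree E w v"
      using finE PE not_P by (intro sum.mono_neutral_left) auto
    moreover have "v \<in> V" "1 \<le> weighted_degree E w v" using v by (auto simp: T_def)
    ultimately show "(\<Sum>e | e \<in> P \<and> v \<in> e. w e) = 1"
      using deg_w[of v] by simp
  next
    fix e assume "e \<in> P" "w e < w' e"
    then have e: "e \<in> R" "e \<in> E" using PE by (auto simp: R_P)
    \<comment> \<open>\<open>T\<close> separates the ends of a raised edge, so the partial integral
      over \<open>e \<inter> T\<close> is the one inside \<open>S_op\<close> at the end
      \<open>u e\<close>.\<close>
    have split: "e - T = {a}" "e \<inter> T = {b}" "other_end e a = b"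
      if "e = {a, b}" "a \<noteq> b" "a \<notin> T" "b \<in> T" for a b
    proof -
      have "e - {a} = {b}" using that by auto
      then show "e - T = {a}" "e \<inter> T = {b}" "other_end e a = b"
        using that by (auto simp: other_end_def)
    qed
    note diff = split[OF ut(1,2,4,5)[OF e(1)]]
    have V: "u e \<in> V" "t e \<in> V" using EV[OF e(2)] ut(1)[OF e(1)] by auto
    have m: "m e = ess_sup_abs (M (u e)) (\<lambda>s. L_norm (M (t e)) (1 / ennreal (w' e))
        (\<lambda>r. f e (edge_point {u e, t e} (u e) s r)))"
      unfolding m_def mixed_norm_def S_op_def diff MB[OF V(1)] MB[OF V(2)] ut(1)[OF e(1), symmetric] ..
    show "AE y in PiM (e - T) M.
        (\<integral>z. h e (merge (e - T) (e \<inter> T) (y, z)) \<partial>PiM (e \<inter> T) M) \<le> C e"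
      unfolding diff h_def C_def m
      by (rule section_integral_le_ess_sup[OF ut(2)[OF e(1)] _ _ w'_pos[OF \<open>e \<in> P\<close>]])
         (use g(1,2)[OF e(2)] in \<open>simp_all only: ut(1)[OF e(1), symmetric]\<close>)
  qed (use finV PE EV w0 le w'_pos bh T_def in auto)

  \<comment> \<open>Reduction of the original integral to the representatives\<close>
  have D0: "0 \<le> D" unfolding D_def by (simp add: prod_nonneg ess_sup_abs_nonneg)
  have "bounded_nonneg (PiM V M) (\<lambda>x. D * (\<Prod>e\<in>P. h e (restrict x e) powr w' e))"
    using bh PE EV w'_pos D0
    by (intro bounded_nonneg_mult bounded_nonneg_const bounded_nonneg_prod bounded_nonneg_powr
        bounded_nonneg_restrict) (auto simp: less_imp_le)
  note bF = this bounded_nonneg_measurable[OF this]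
    bounded_nonneg_integrable[OF finite_measure_PiM[OF finV] this]
  have sup_e: "AE x in PiM e M. \<bar>f e x\<bar> \<le> ess_sup_abs (completion (PiM e M)) (f e)" if "e \<in> E" for e
  proof -
    have "AE x in completion (PiM e M). \<bar>f e x\<bar> \<le> K e"
      using K[OF that] by (intro AE_I2) simp
    from AE_le_ess_sup_abs[OF f_meas[OF that] this] show ?thesis
      by (simp add: AE_completion_iff)
  qed
  have "AE x in PiM V M. \<forall>e\<in>E. \<bar>f e (restrict x e)\<bar>
      \<le> (if e \<in> P then h e (restrict x e) powr w' e else ess_sup_abs (completion (PiM e M)) (f e))"
  proof (rule AE_finite_allI[OF finE])
    fix e assume e: "e \<in> E"
    have "AE y in PiM e M. \<bar>f e y\<bar>
      \<le> (if e \<in> P then h e y powr w' e else ess_sup_abs (completion (PiM e M)) (f e))"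
      using g(2)[OF e] sup_e[OF e]
    proof eventually_elim
      case (elim y)
      then have "0 \<le> g e y" by (metis abs_ge_zero)
      then show ?case using elim w'_pos[of e] by (auto simp: h_def powr_powr)
    qed
    then show "AE x in PiM V M. \<bar>f e (restrict x e)\<bar>
      \<le> (if e \<in> P then h e (restrict x e) powr w' e else ess_sup_abs (completion (PiM e M)) (f e))"
      by (rule AE_PiM_restrict[OF finV EV[OF e]])
  qed
  then have bound: "AE x in PiM V M. (\<Prod>e\<in>E. f e (restrict x e)) \<le> D * (\<Prod>e\<in>P. h e (restrict x e) powr w' e)"
  proof eventually_elim
    case (elim x)
    have "(\<Prod>e\<in>E. f e (restrict x e)) \<le> (\<Prod>e\<in>E. \<bar>f e (restrict x e)\<bar>)"
      by (metis abs_ge_self abs_prod)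
    also have "\<dots> \<le> (\<Prod>e\<in>E. if e \<in> P then h e (restrict x e) powr w' e
        else ess_sup_abs (completion (PiM e M)) (f e))"
      using elim by (intro prod_mono) auto
    also have "\<dots> = D * (\<Prod>e\<in>P. h e (restrict x e) powr w' e)"
      unfolding D_def prod.subset_diff[OF PE(1) finE]
      by (intro arg_cong2[where f = "(*)"] prod.cong) auto
    finally show ?case .
  qed
  \<comment> \<open>The majorant is integrable and nonnegative, which also covers the default value
    0 of the integral on the left.\<close>
  have "(\<integral>x. (\<Prod>e\<in>E. f e (restrict x e)) \<partial>box_measure B V)
    \<le> (\<integral>x. D * (\<Prod>e\<in>P. h e (restrict x e) powr w' e) \<partial>completion (PiM V M))"
    unfolding box[OF order_refl]
  proof (rule integral_mono_AE')
    show "integrable (completion (PiM V M)) (\<lambda>x. D * (\<Prod>e\<in>P. h e (restrict x e) powr w' e))"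
      using bF(2,3) by (simp only: integrable_completion)
  qed (use AE_completion[OF bound] D0 in \<open>auto simp: prod_nonneg\<close>)
  also have "\<dots> = D * (\<integral>x. (\<Prod>e\<in>P. h e (restrict x e) powr w' e) \<partial>PiM V M)"
    unfolding integral_completion[OF bF(2)] by simp
  also have "\<dots> \<le> D * ((\<Prod>e\<in>R. C e powr (w' e - w e)) * (\<Prod>e | e \<in> P \<and> 0 < w e. I e powr w e))"
    using mult_left_mono[OF two_stage D0] by (simp only: R_P)
  also have "\<dots> = (\<Prod>e\<in>R. C e powr (w' e - w e)) * ((\<Prod>e | e \<in> P \<and> 0 < w e. I e powr w e) * D)"
    by simp

  \<comment> \<open>Identification of the two factors with the norms\<close>
  also have "(\<Prod>e\<in>R. C e powr (w' e - w e)) = (\<Prod>v\<in>S'. \<Prod>e | e \<in> E \<and> v \<in> e.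
      rpow (mixed_norm B e v (1 / ennreal (w' e)) (f e)) (excess_ratio (w e) (w' e)))"
  proof (subst prod_incident_single[where R = R and u = u])
    show "finite S'" using finV unfolding assms(9) by simp
    have "{v \<in> S'. v \<in> e} = {a}" if "e = {a, b}" "a \<in> S'" "b \<notin> S'" for e a b
      using that by auto
    then show "{v \<in> S'. v \<in> e} = {u e}" if "e \<in> R" for e
      using ut(1,3,6)[OF that] by this
    \<comment> \<open>Outside \<open>R\<close> the weights agree, so the exponent is 0 and
      \<open>rpow\<close> gives 1 even when the norm vanishes.\<close>
    show "rpow (mixed_norm B e v (1 / ennreal (w' e)) (f e)) (excess_ratio (w e) (w' e)) = 1"
      if "e \<in> E - R" for e v
      using that le[of e] by (auto simp: R_def rpow_def excess_ratio_def)
    have "0 \<le> m e" for e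
      unfolding m_def mixed_norm_def by (rule ess_sup_abs_nonneg)
    then show "(\<Prod>e\<in>R. C e powr (w' e - w e)) = (\<Prod>e\<in>R.
      rpow (mixed_norm B e (u e) (1 / ennreal (w' e)) (f e)) (excess_ratio (w e) (w' e)))"
      using w0 by (intro prod.cong) (auto simp: R_def C_def rpow_excess_ratio m_def[symmetric])
  qed (use finE RE in auto)
  also have "(\<Prod>e | e \<in> P \<and> 0 < w e. I e powr w e) * D
    = (\<Prod>e\<in>E. rpow (edge_norm B e (1 / ennreal (w' e)) (f e)) (matching_ratio (w e) (w' e)))"
  proof -
    have "(\<Prod>e | e \<in> P \<and> 0 < w e. I e powr w e) = (\<Prod>e\<in>P. if 0 < w e then I e powr w e else 1)"
      using PE by (simp add: prod.inter_filter)
    also have "\<dots> = (\<Prod>e\<in>P. rpow (edge_norm B e (1 / ennreal (w' e)) (f e)) (matching_ratio (w e) (w' e)))"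
    proof (rule prod.cong)
      fix e assume e: "e \<in> P"
      then have eE: "e \<in> E" using PE by auto
      have "edge_norm B e (1 / ennreal (w' e)) (f e) = I e powr w' e"
        unfolding edge_norm_def box[OF EV[OF eE]] I_def h_def
        using L_norm_completion_representative[OF f_meas[OF eE] g[OF eE] w'_pos[OF e]] .
      then show "(if 0 < w e then I e powr w e else 1)
        = rpow (edge_norm B e (1 / ennreal (w' e)) (f e)) (matching_ratio (w e) (w' e))"
        using w'_pos[OF e] w0[OF eE] by (simp add: rpow_matching_ratio)
    qed simp
    finally have 1: "(\<Prod>e | e \<in> P \<and> 0 < w e. I e powr w e) = \<dots>" .
    \<comment> \<open>Both weights are 0 here: \<open>1 / ennreal 0\<close> is \<open>top\<close>,
      so \<open>edge_norm\<close> is the essential supremum, and \<open>matching_ratio\<close> is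
      1.\<close>
    have 2: "D = (\<Prod>e\<in>E - P. rpow (edge_norm B e (1 / ennreal (w' e)) (f e)) (matching_ratio (w e) (w' e)))"
      unfolding D_def
    proof (rule prod.cong)
      fix e assume e: "e \<in> E - P"
      then show "ess_sup_abs (completion (PiM e M)) (f e)
        = rpow (edge_norm B e (1 / ennreal (w' e)) (f e)) (matching_ratio (w e) (w' e))"
        using not_P[OF e] box[OF EV[of e]]
        by (simp add: rpow_def matching_ratio_def edge_norm_def L_norm_def ess_sup_abs_nonneg)
    qed simp
    show ?thesis
      unfolding 1 2 prod.subset_diff[OF PE(1) finE] by (rule mult.commute)
  qed
  finally show ?thesis .
qed

end
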